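(* Let $n$ denote the number of vertices of the input graph and let $k$ be the input integer, with $k\le n^2/4$, and put $r=k/n$. Then Min-Sum 2-Clustering can be solved in $O\!\left(n\cdot 2.619^{\,r/(1-4r/n)}+n^3\right)$ time.
   Context: Let $G=(V,E)$ be a simple undirected graph with $n=|V|$. A 2-partition of $V$ is an unordered pair $\pi=(V_1,V_2)$ with $V_1\cap V_2=\emptyset$ and $V_1\cup V_2=V$ (the sets $V_1,V_2$ are called clusters). Two distinct vertices $u,v$ are in conflict in $\pi$ if they lie in the same cluster and $(u,v)\notin E$, or they lie in different clusters and $(u,v)\in E$. The conflict number $c_\pi(v)$ is the number of vertices in conflict with $v$. Let $h_1(\pi)=\sum_{v\in V}c_\pi(v)$. The decision problem Min-Sum 2-Clustering: given a graph $G=(V,E)$ and a nonnegative integer $k$, decide whether there is a 2-partition $\pi=(V_1,V_2)$ of $V$ with $V_1\neq\emptyset$, $V_2\neq\emptyset$ and $h_1(\pi)\le k$. *)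

theory Defs
  imports Complex_Main "Graph_Theory.Pair_Digraph"
begin

section \<open>Min-Sum 2-Clustering\<close>

text \<open>
  A simple undirected graph is a \<^const>\<open>pair_graph\<close>: finite, loop-free, and with a symmetric
  set of arcs, so that the arc \<^term>\<open>(u, v)\<close> stands for the undirected edge between
  \<^term>\<open>u\<close> and \<^term>\<open>v\<close>.  A 2-partition is represented by a pair of
  clusters; it is meant to be unordered, and all notions below are invariant under swapping the
  two clusters.
\<close>

definition two_partition :: "'a set \<Rightarrow> 'a set \<times> 'a set \<Rightarrow> bool" where
  "two_partition V \<pi> \<longleftrightarrow> fst \<pi> \<inter> snd \<pi> = {} \<and> fst \<pi> \<union> snd \<pi> = V"

definition same_cluster :: "'a set \<times> 'a set \<Rightarrow> 'a \<Rightarrow> 'a \<Rightarrow> bool" where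
  "same_cluster \<pi> u v \<longleftrightarrow> (u \<in> fst \<pi> \<and> v \<in> fst \<pi>) \<or> (u \<in> snd \<pi> \<and> v \<in> snd \<pi>)"

definition different_clusters :: "'a set \<times> 'a set \<Rightarrow> 'a \<Rightarrow> 'a \<Rightarrow> bool" where
  "different_clusters \<pi> u v \<longleftrightarrow> (u \<in> fst \<pi> \<and> v \<in> snd \<pi>) \<or> (u \<in> snd \<pi> \<and> v \<in> fst \<pi>)"

definition in_conflict :: "'a pair_pre_digraph \<Rightarrow> 'a set \<times> 'a set \<Rightarrow> 'a \<Rightarrow> 'a \<Rightarrow> bool" where
  "in_conflict G \<pi> u v \<longleftrightarrow> u \<noteq> v \<and>
     ((same_cluster \<pi> u v \<and> (u, v) \<notin> parcs G) \<or> (different_clusters \<pi> u v \<and> (u, v) \<in> parcs G))"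

definition conflict_number :: "'a pair_pre_digraph \<Rightarrow> 'a set \<times> 'a set \<Rightarrow> 'a \<Rightarrow> nat" where
  "conflict_number G \<pi> v = card {u \<in> pverts G. in_conflict G \<pi> u v}"

definition h1 :: "'a pair_pre_digraph \<Rightarrow> 'a set \<times> 'a set \<Rightarrow> nat" where
  "h1 G \<pi> = (\<Sum>v\<in>pverts G. conflict_number G \<pi> v)"

definition min_sum_2_clustering :: "'a pair_pre_digraph \<Rightarrow> nat \<Rightarrow> bool" where
  "min_sum_2_clustering G k \<longleftrightarrow>
     (\<exists>V1 V2. two_partition (pverts G) (V1, V2) \<and> V1 \<noteq> {} \<and> V2 \<noteq> {} \<and> h1 G (V1, V2) \<le> k)"


section \<open>A random access machine with bounded words\<close>

text \<open>
  Running time is measured on a word RAM, programmed in a while language.  The store consists of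
  random access arrays of natural numbers; the array names in a program are constants, so each
  program uses only finitely many arrays, which amounts to a single memory with the arrays
  interleaved.  A scalar variable is the cell 0 of an array.  The arithmetic operations are
  addition and truncated subtraction; a test succeeds if its value is nonzero.  Every array access,
  constant, arithmetic operation, assignment and test costs one unit of time.
\<close>

type_synonym store = "nat \<Rightarrow> nat \<Rightarrow> nat"

datatype expr =
    Const nat
  | Read nat expr
  | Add expr expr
  | Sub expr expr

datatype prog =
    Skip
  | Write nat expr expr
  | Seq prog prog
  | Cond expr prog prog
  | Loop expr prog

fun eval_expr :: "expr \<Rightarrow> store \<Rightarrow> nat" where
  "eval_expr (Const c) s = c"
| "eval_expr (Read a e) s = s a (eval_expr e s)"
| "eval_expr (Add e f) s = eval_expr e s + eval_expr f s"
| "eval_expr (Sub e f) s = eval_expr e s - eval_expr f s"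

fun expr_cost :: "expr \<Rightarrow> nat" where
  "expr_cost (Const c) = 1"
| "expr_cost (Read a e) = 1 + expr_cost e"
| "expr_cost (Add e f) = 1 + expr_cost e + expr_cost f"
| "expr_cost (Sub e f) = 1 + expr_cost e + expr_cost f"

text \<open>
  \<^term>\<open>run W p s t s'\<close>: started in \<^term>\<open>s\<close>, the program
  \<^term>\<open>p\<close> terminates in \<^term>\<open>s'\<close> after \<^term>\<open>t\<close> time units, and
  all addresses written to and all numbers stored are less than \<^term>\<open>W\<close>.  A write
  violating this has no successor, so an overflowing computation does not terminate properly.
\<close>

inductive run :: "nat \<Rightarrow> prog \<Rightarrow> store \<Rightarrow> nat \<Rightarrow> store \<Rightarrow> bool" for W :: nat where
  Skip: "run W Skip s 1 s"
| Write: "eval_expr i s < W \<Longrightarrow> eval_expr e s < W \<Longrightarrow>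
    run W (Write a i e) s (1 + expr_cost i + expr_cost e)
      (s(a := (s a)(eval_expr i s := eval_expr e s)))"
| Seq: "run W p s t s' \<Longrightarrow> run W q s' t' s'' \<Longrightarrow> run W (Seq p q) s (t + t') s''"
| CondTrue: "eval_expr b s \<noteq> 0 \<Longrightarrow> run W p s t s' \<Longrightarrow>
    run W (Cond b p q) s (1 + expr_cost b + t) s'"
| CondFalse: "eval_expr b s = 0 \<Longrightarrow> run W q s t s' \<Longrightarrow>
    run W (Cond b p q) s (1 + expr_cost b + t) s'"
| LoopFalse: "eval_expr b s = 0 \<Longrightarrow> run W (Loop b p) s (1 + expr_cost b) s"
| LoopTrue: "eval_expr b s \<noteq> 0 \<Longrightarrow> run W p s t s' \<Longrightarrow> run W (Loop b p) s' t' s'' \<Longrightarrow>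
    run W (Loop b p) s (1 + expr_cost b + t + t') s''"

lemma run_deterministic:
  "run W p s t s' \<Longrightarrow> run W p s u s'' \<Longrightarrow> t = u \<and> s' = s''"
proof (induction arbitrary: u s'' rule: run.induct)
  case (Skip s)
  then show ?case by cases simp
next
  case (Write i s e a)
  from Write.prems show ?case by cases simp
next
  case (Seq p s t s' q t' s2)
  from Seq.prems obtain v v' r where r: "run W p s v r" "run W q r v' s''" "u = v + v'"
    by cases
  from Seq.IH(1)[OF r(1)] have e: "t = v" "s' = r" by simp_all
  with Seq.IH(2)[of v' s''] r show ?case by simp
next
  case (CondTrue b s p t s' q)
  from CondTrue.prems obtain v where v: "run W p s v s''" "u = 1 + expr_cost b + v"
    using CondTrue.hyps by cases simp_all
  from CondTrue.IH[OF v(1)] v(2) show ?case by simp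
next
  case (CondFalse b s q t s' p)
  from CondFalse.prems obtain v where v: "run W q s v s''" "u = 1 + expr_cost b + v"
    using CondFalse.hyps by cases simp_all
  from CondFalse.IH[OF v(1)] v(2) show ?case by simp
next
  case (LoopFalse b s p)
  from LoopFalse.prems show ?case using LoopFalse.hyps by cases simp_all
next
  case (LoopTrue b s p t s' t' s2)
  from LoopTrue.prems obtain v v' r
    where r: "run W p s v r" "run W (Loop b p) r v' s''" "u = 1 + expr_cost b + v + v'"
    using LoopTrue.hyps by cases simp_all
  from LoopTrue.IH(1)[OF r(1)] have e: "t = v" "s' = r" by simp_all
  with LoopTrue.IH(2)[of v' s''] r show ?case by simp
qed

text \<open>
  The input graph has the vertices \<open>0, \<dots>, n - 1\<close>.  Array 0 initially holds \<open>n\<close> and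
  \<open>k\<close>, array 1 the adjacency matrix in row-major order, and all other cells are 0.
\<close>

definition input_store :: "nat \<Rightarrow> nat pair_pre_digraph \<Rightarrow> nat \<Rightarrow> store" where
  "input_store n G k = (\<lambda>_ _. 0)
     (0 := (\<lambda>_. 0)(0 := n, 1 := k),
      1 := (\<lambda>i. if i < n * n \<and> (i div n, i mod n) \<in> parcs G then 1 else 0))"

end

theory Submission
  imports Defs "HOL-Library.Nat_Bijection"
begin

text \<open>
  In a clustering with at most \<open>k = r n\<close> conflicts some vertex \<open>v\<close> has \<open>d \<le> r\<close> conflicts, so the
  clustering arises from the closed neighbourhood of \<open>v\<close> and its complement by flipping \<open>d\<close> vertices.
  If the clustering is optimal and \<open>v\<close> has the fewest conflicts, then only vertices with at least
  \<open>n / 2 - d\<close> conflicts can be flipped.  Since every vertex uses up at least \<open>d\<close> conflicts, there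
  are at most \<open>2 x - d\<close> such candidates if \<open>r < n / 6\<close>, where \<open>x = r / (1 - 4 r / n)\<close>.  The number of ways
  to choose \<open>d\<close> out of \<open>2 x - d\<close> elements is at most \<open>\<phi> ^ (2 x)\<close> for the golden ratio \<open>\<phi>\<close>, and
  \<open>\<phi>\<^sup>2 < 2.619\<close>.  The effect of a flip on the number of conflicts is read off the conflict numbers
  and the conflict matrix of the start clustering in time polynomial in the number of candidates.
\<close>

section \<open>Conflicts and flips\<close>

text \<open>The optimal clustering is unknown to the program, so neither \<open>d\<close> nor the
  bound on the candidates can be read off it. Every \<open>d\<close> with
  \<open>d * n \<le> k\<close> is tried, and the counting consequence of optimality becomes the
  inequality \<open>admissible\<close> in \<open>n\<close>, \<open>k\<close>, \<open>d\<close> and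
  \<open>N\<close> alone. It holds for the right start and the right \<open>d\<close>, which gives
  completeness; wherever it holds, it bounds the number of subsets, which gives the running time.
  Other starts are rejected before any enumeration. Eliminating \<open>d\<close> produces the
  exponent: \<open>admissible\<close> yields N + d <= 2 (k - 6 d^2) / (n - 6 d), and this is at most
  2 k n / (n^2 - 4 k) = 2 x. The golden ratio is the fixed point of y = 1 + 1/y, for which the bound
  y^d (1 + 1/y)^N on the number of subsets depends on N + d only. The target allows one factor n
  before the exponential. The r + 1 rounds and the quadratic cost of a test must vanish in the gap
  between 2.618... and 2.619, so a test may cost a polynomial in N but not in n. Hence conflict
  numbers and matrix are computed once per start in time O(n^2), the source of n^3.\<close>

definition conflict :: "('a \<Rightarrow> 'a \<Rightarrow> bool) \<Rightarrow> ('a \<Rightarrow> bool) \<Rightarrow> 'a \<Rightarrow> 'a \<Rightarrow> bool" where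
  "conflict E \<sigma> u w \<longleftrightarrow> u \<noteq> w \<and> (\<sigma> u = \<sigma> w) \<noteq> E u w"

definition conflicts :: "('a \<Rightarrow> 'a \<Rightarrow> bool) \<Rightarrow> 'a set \<Rightarrow> ('a \<Rightarrow> bool) \<Rightarrow> 'a \<Rightarrow> nat" where
  "conflicts E A \<sigma> u = (\<Sum>w\<in>A. of_bool (conflict E \<sigma> u w))"

definition total_conflicts :: "('a \<Rightarrow> 'a \<Rightarrow> bool) \<Rightarrow> 'a set \<Rightarrow> ('a \<Rightarrow> bool) \<Rightarrow> nat" where
  "total_conflicts E V \<sigma> = (\<Sum>u\<in>V. conflicts E V \<sigma> u)"

definition flip :: "'a set \<Rightarrow> ('a \<Rightarrow> bool) \<Rightarrow> 'a \<Rightarrow> bool" where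
  "flip D \<sigma> u \<longleftrightarrow> \<sigma> u \<noteq> (u \<in> D)"

definition nontrivial :: "'a set \<Rightarrow> ('a \<Rightarrow> bool) \<Rightarrow> bool" where
  "nontrivial V \<sigma> \<longleftrightarrow> (\<exists>u\<in>V. \<sigma> u) \<and> (\<exists>u\<in>V. \<not> \<sigma> u)"

definition good_clustering :: "('a \<Rightarrow> 'a \<Rightarrow> bool) \<Rightarrow> 'a set \<Rightarrow> nat \<Rightarrow> ('a \<Rightarrow> bool) \<Rightarrow> bool" where
  "good_clustering E V k \<sigma> \<longleftrightarrow> nontrivial V \<sigma> \<and> total_conflicts E V \<sigma> \<le> k"

lemma conflict_flip:
  "conflict E (flip D \<sigma>) u w \<longleftrightarrow>
    (if (u \<in> D) = (w \<in> D) then conflict E \<sigma> u w else \<not> conflict E \<sigma> u w)"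
  unfolding conflict_def flip_def by auto

lemma conflicts_split:
  assumes "finite V" "D \<subseteq> V"
  shows "conflicts E V \<sigma> u = conflicts E D \<sigma> u + conflicts E (V - D) \<sigma> u"
  unfolding conflicts_def using sum.subset_diff[OF assms(2,1)] by (simp add: add.commute)

lemma sum_not_conflict:
  assumes "finite A"
  shows "(\<Sum>w\<in>A. of_bool (\<not> conflict E \<sigma> u w)) = int (card A) - int (conflicts E A \<sigma> u)"
  using assms unfolding conflicts_def by (simp add: of_bool_not_iff sum_subtractf)

text \<open>Pairs on the same side of \<open>D\<close> keep their status and all other pairs are
  complemented. The equation lives in the integers because both cases subtract.\<close>

lemma conflicts_flip:
  assumes "finite V" "D \<subseteq> V"
  shows "int (conflicts E V (flip D \<sigma>) u) =
    (if u \<in> D then int (card V) - card D - conflicts E V \<sigma> u + 2 * conflicts E D \<sigma> u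
     else int (conflicts E V \<sigma> u) + card D - 2 * conflicts E D \<sigma> u)"
proof -
  have fin: "finite D" using assms finite_subset by blast
  have card: "int (card (V - D)) = int (card V) - int (card D)"
    using assms fin by (simp add: card_Diff_subset card_mono of_nat_diff)
  show ?thesis
  proof (cases "u \<in> D")
    case True
    have "int (conflicts E (V - D) (flip D \<sigma>) u) = (\<Sum>w\<in>V - D. of_bool (\<not> conflict E \<sigma> u w))"
      unfolding conflicts_def of_nat_sum using True by (intro sum.cong) (auto simp: conflict_flip)
    moreover have "conflicts E D (flip D \<sigma>) u = conflicts E D \<sigma> u"
      unfolding conflicts_def using True by (intro sum.cong) (auto simp: conflict_flip)
    ultimately show ?thesis
      using True card sum_not_conflict[of "V - D" E \<sigma> u] assms
      by (simp add: conflicts_split[OF assms])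
  next
    case False
    have "int (conflicts E D (flip D \<sigma>) u) = (\<Sum>w\<in>D. of_bool (\<not> conflict E \<sigma> u w))"
      unfolding conflicts_def of_nat_sum using False by (intro sum.cong) (auto simp: conflict_flip)
    moreover have "conflicts E (V - D) (flip D \<sigma>) u = conflicts E (V - D) \<sigma> u"
      unfolding conflicts_def using False by (intro sum.cong) (auto simp: conflict_flip)
    ultimately show ?thesis
      using False sum_not_conflict[OF fin, of E \<sigma> u] by (simp add: conflicts_split[OF assms])
  qed
qed

text \<open>Only the \<open>card D * (card V - card D)\<close> pairs with exactly one end in
  \<open>D\<close> change status, and the conflicts among them number the sum of
  \<open>conflicts E V \<sigma> u - conflicts E D \<sigma> u\<close> over \<open>D\<close>. Every
  pair counts twice, and negative terms are moved across to stay in the natural numbers.\<close>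

lemma total_conflicts_flip:
  assumes "finite V" "D \<subseteq> V" and sym: "\<And>u w. E u w = E w u"
  shows "total_conflicts E V (flip D \<sigma>) + 4 * (\<Sum>u\<in>D. conflicts E V \<sigma> u) =
    total_conflicts E V \<sigma> + 2 * (card D * (card V - card D)) + 4 * (\<Sum>u\<in>D. conflicts E D \<sigma> u)"
proof -
  have fin: "finite D" using assms finite_subset by blast
  have le: "card D \<le> card V" using assms by (simp add: card_mono)
  let ?c = "\<lambda>A u. int (conflicts E A \<sigma> u)"
  have swap: "(\<Sum>u\<in>V - D. ?c D u) = (\<Sum>u\<in>D. ?c (V - D) u)"
    unfolding conflicts_def of_nat_sum
    by (subst sum.swap) (intro sum.cong refl, auto simp: conflict_def sym)
  have "int (total_conflicts E V (flip D \<sigma>)) =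
      (\<Sum>u\<in>V - D. int (conflicts E V (flip D \<sigma>) u)) + (\<Sum>u\<in>D. int (conflicts E V (flip D \<sigma>) u))"
    unfolding total_conflicts_def of_nat_sum using sum.subset_diff[OF assms(2,1)] by blast
  also have "\<dots> = (\<Sum>u\<in>V - D. ?c V u + card D - 2 * ?c D u) +
      (\<Sum>u\<in>D. int (card V) - card D - ?c V u + 2 * ?c D u)"
    by (intro arg_cong2[where f = "(+)"] sum.cong) (auto simp: conflicts_flip[OF assms(1,2)])
  also have "\<dots> = (\<Sum>u\<in>V - D. ?c V u) + card (V - D) * int (card D) - 2 * (\<Sum>u\<in>V - D. ?c D u)
      + card D * (int (card V) - card D) - (\<Sum>u\<in>D. ?c V u) + 2 * (\<Sum>u\<in>D. ?c D u)"
    by (simp add: sum.distrib sum_subtractf sum_distrib_left)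
  also have "\<dots> = (\<Sum>u\<in>V - D. ?c V u) + 2 * (card D * (int (card V) - card D))
      - 2 * (\<Sum>u\<in>D. ?c V u - ?c D u) - (\<Sum>u\<in>D. ?c V u) + 2 * (\<Sum>u\<in>D. ?c D u)"
    unfolding swap using le assms fin
    by (simp add: conflicts_split[OF assms(1,2)] card_Diff_subset of_nat_diff algebra_simps)
  also have "(\<Sum>u\<in>V - D. ?c V u) = int (total_conflicts E V \<sigma>) - (\<Sum>u\<in>D. ?c V u)"
    unfolding total_conflicts_def of_nat_sum using sum.subset_diff[OF assms(2,1), of "?c V"] by simp
  finally have "int (total_conflicts E V (flip D \<sigma>) + 4 * (\<Sum>u\<in>D. conflicts E V \<sigma> u)) =
    int (total_conflicts E V \<sigma> + 2 * (card D * (card V - card D)) + 4 * (\<Sum>u\<in>D. conflicts E D \<sigma> u))"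
    using le by (simp add: sum_subtractf of_nat_diff)
  then show ?thesis by (simp only: of_nat_eq_iff)
qed

lemma total_conflicts_cong:
  assumes "\<And>u w. u \<in> V \<Longrightarrow> w \<in> V \<Longrightarrow> (\<sigma> u = \<sigma> w) = (\<tau> u = \<tau> w)"
  shows "total_conflicts E V \<sigma> = total_conflicts E V \<tau>"
  unfolding total_conflicts_def conflicts_def
  by (intro sum.cong refl arg_cong[where f = of_bool]) (use assms in \<open>simp add: conflict_def\<close>)

text \<open>Partitions are unordered, so only the relation \<open>\<sigma> u = \<sigma> w\<close>
  matters. This allows a clustering to be replaced by its complement.\<close>

lemma good_clustering_cong:
  assumes "\<And>u w. u \<in> V \<Longrightarrow> w \<in> V \<Longrightarrow> (\<sigma> u = \<sigma> w) = (\<tau> u = \<tau> w)"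
    and "good_clustering E V k \<sigma>"
  shows "good_clustering E V k \<tau>"
proof -
  have "nontrivial V \<tau>" using assms unfolding good_clustering_def nontrivial_def by metis
  then show ?thesis
    using assms(2) total_conflicts_cong[of V \<sigma> \<tau> E, OF assms(1)] unfolding good_clustering_def by simp
qed

lemma sum_of_bool_flip:
  assumes "finite V" "D \<subseteq> V"
  shows "(\<Sum>u\<in>V. of_bool (flip D \<sigma> u)) + (\<Sum>u\<in>D. of_bool (\<sigma> u)) =
    (\<Sum>u\<in>V. of_bool (\<sigma> u)) + (\<Sum>u\<in>D. of_bool (\<not> \<sigma> u) :: nat)"
proof -
  have "(\<Sum>u\<in>V - D. of_bool (flip D \<sigma> u)) = (\<Sum>u\<in>V - D. of_bool (\<sigma> u) :: nat)"
    by (intro sum.cong) (auto simp: flip_def)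
  moreover have "(\<Sum>u\<in>D. of_bool (flip D \<sigma> u)) = (\<Sum>u\<in>D. of_bool (\<not> \<sigma> u) :: nat)"
    by (intro sum.cong) (auto simp: flip_def)
  ultimately show ?thesis by (simp add: sum.subset_diff[OF assms(2,1)])
qed

lemma nontrivial_iff:
  assumes "finite V"
  shows "nontrivial V \<sigma> \<longleftrightarrow> 0 < (\<Sum>u\<in>V. of_bool (\<sigma> u) :: nat) \<and> (\<Sum>u\<in>V. of_bool (\<sigma> u)) < card V"
proof -
  have e: "(\<Sum>u\<in>V. of_bool (\<sigma> u)) = card {u\<in>V. \<sigma> u}"
    using assms by (simp add: of_bool_def sum.If_cases Int_def)
  have "0 < card {u\<in>V. \<sigma> u} \<longleftrightarrow> (\<exists>u\<in>V. \<sigma> u)" using assms by (auto simp: card_gt_0_iff)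
  moreover have "card {u\<in>V. \<sigma> u} < card V \<longleftrightarrow> (\<exists>u\<in>V. \<not> \<sigma> u)"
  proof
    assume "card {u\<in>V. \<sigma> u} < card V"
    then have "{u\<in>V. \<sigma> u} \<noteq> V" by auto
    then show "\<exists>u\<in>V. \<not> \<sigma> u" by blast
  next
    assume "\<exists>u\<in>V. \<not> \<sigma> u"
    then show "card {u\<in>V. \<sigma> u} < card V" using assms by (intro psubset_card_mono) auto
  qed
  ultimately show ?thesis unfolding nontrivial_def e by simp
qed

text \<open>The form evaluated by the program: apart from totals of the start clustering, only sums
  over \<open>D\<close> and over pairs in \<open>D\<close> occur, and they are arranged so that no
  sum is subtracted from another.\<close>

lemma good_clustering_flip_iff:
  assumes "finite V" "D \<subseteq> V" "\<And>u w. E u w = E w u"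
  shows "good_clustering E V k (flip D \<sigma>) \<longleftrightarrow>
    total_conflicts E V \<sigma> + (\<Sum>u\<in>D. 2 * (card V - card D) + 4 * conflicts E D \<sigma> u)
      \<le> k + (\<Sum>u\<in>D. 4 * conflicts E V \<sigma> u) \<and>
    (\<Sum>u\<in>D. of_bool (\<sigma> u)) < (\<Sum>u\<in>V. of_bool (\<sigma> u)) + (\<Sum>u\<in>D. of_bool (\<not> \<sigma> u) :: nat) \<and>
    (\<Sum>u\<in>V. of_bool (\<sigma> u)) + (\<Sum>u\<in>D. of_bool (\<not> \<sigma> u)) < card V + (\<Sum>u\<in>D. of_bool (\<sigma> u) :: nat)"
  using total_conflicts_flip[where \<sigma> = \<sigma> and E = E, OF assms] sum_of_bool_flip[OF assms(1,2), of \<sigma>]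
    nontrivial_iff[OF assms(1), of "flip D \<sigma>"]
  unfolding good_clustering_def by (auto simp: sum.distrib sum_distrib_left mult.assoc)

section \<open>Completeness of the search\<close>

text \<open>
  Suppose that a minimum nontrivial clustering arises from \<open>\<sigma>\<close> by flipping \<open>d\<close> vertices, where
  \<open>d\<close> is its minimum conflict number.  A vertex with at least \<open>n / 2\<close> conflicts could be moved
  profitably, so each flipped vertex has at least \<open>n / 2 - d\<close> conflicts in \<open>\<sigma>\<close>: it is a candidate.
  A candidate that is not flipped keeps at least \<open>n / 2 - 2 d\<close> conflicts, which exceeds the minimum
  by \<open>n / 2 - 3 d\<close>; the total excess over the minimum is at most \<open>k - d n\<close>.  This is the bound on
  the number \<open>N\<close> of candidates in \<open>admissible\<close>; for \<open>n \<le> 6 d\<close> the truncated subtraction makes it void.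
\<close>

definition candidates :: "('a \<Rightarrow> 'a \<Rightarrow> bool) \<Rightarrow> 'a set \<Rightarrow> ('a \<Rightarrow> bool) \<Rightarrow> nat \<Rightarrow> 'a set" where
  "candidates E V \<sigma> d = {u\<in>V. card V \<le> 2 * conflicts E V \<sigma> u + 2 * d}"

definition admissible :: "nat \<Rightarrow> nat \<Rightarrow> nat \<Rightarrow> nat \<Rightarrow> bool" where
  "admissible n k d N \<longleftrightarrow> d * n \<le> k \<and> (N - d) * (n - 6 * d) \<le> 2 * (k - d * n)"

definition search_succeeds ::
  "('a \<Rightarrow> 'a \<Rightarrow> bool) \<Rightarrow> 'a set \<Rightarrow> nat \<Rightarrow> ('a \<Rightarrow> bool) \<Rightarrow> nat \<Rightarrow> bool" where
  "search_succeeds E V k \<sigma> d \<longleftrightarrow> admissible (card V) k d (card (candidates E V \<sigma> d)) \<and>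
    (\<exists>D \<subseteq> candidates E V \<sigma> d. card D \<le> d \<and> good_clustering E V k (flip D \<sigma>))"

text \<open>
  The singleton starts are needed for optimal clusterings in which the profitable move of a vertex
  would empty its cluster.
\<close>

theorem search_complete:
  assumes fin: "finite V" and sym: "\<And>u w. E u w = E w u"
    and good: "good_clustering E V k \<sigma>'"
  shows "\<exists>v\<in>V. search_succeeds E V k (\<lambda>u. u = v) 0 \<or>
    (\<exists>d. search_succeeds E V k (\<lambda>u. u = v \<or> E v u) d)"
proof -
  let ?n = "card V"
  define \<sigma> where "\<sigma> = arg_min (total_conflicts E V) (nontrivial V)"
  have nt: "nontrivial V \<sigma>" and opt: "\<And>\<tau>. nontrivial V \<tau> \<Longrightarrow> total_conflicts E V \<sigma> \<le> total_conflicts E V \<tau>"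
    using arg_min_nat_lemma[of "nontrivial V" \<sigma>' "total_conflicts E V"] good
    unfolding \<sigma>_def good_clustering_def by blast+
  have gs: "good_clustering E V k \<sigma>"
    using nt opt[of \<sigma>'] good unfolding good_clustering_def by linarith
  have ne: "V \<noteq> {}" using nt unfolding nontrivial_def by auto
  show ?thesis
  proof (cases "\<exists>u\<in>V. ?n \<le> 2 * conflicts E V \<sigma> u")
    case True
    then obtain u where u: "u \<in> V" "?n \<le> 2 * conflicts E V \<sigma> u" by blast
    have pos: "?n > 0" using ne fin by (simp add: card_gt_0_iff)
    have "conflicts E {u} \<sigma> u = 0" unfolding conflicts_def conflict_def by simp
    \<comment> \<open>Moving \<open>u\<close> changes the sum by 2 (n - 1) - 4 c(u), where c(u) is
      its conflict number, and this is at most -2. By optimality the move must empty a cluster, so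
      \<open>u\<close> is alone in its own.\<close>
    then have "total_conflicts E V (flip {u} \<sigma>) < total_conflicts E V \<sigma>"
      using total_conflicts_flip[where D = "{u}" and V = V and E = E and \<sigma> = \<sigma>, OF fin _ sym] u pos by simp
    then have "\<not> nontrivial V (flip {u} \<sigma>)" using opt[of "flip {u} \<sigma>"] by linarith
    then have single: "\<sigma> w = (\<sigma> u = (w = u))" if "w \<in> V" for w
      using nt u(1) that unfolding nontrivial_def flip_def by (metis singletonD singletonI)
    have "good_clustering E V k (\<lambda>w. w = u)"
      by (rule good_clustering_cong[OF _ gs]) (use single in metis)
    then have "good_clustering E V k (flip {} (\<lambda>w. w = u))"
      unfolding flip_def by simp
    \<comment> \<open>For \<open>d = 0\<close> the condition says that N n is at most 2 k; each
      candidate contributes at least n to twice the conflict sum.\<close>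
    moreover have "admissible ?n k 0 (card (candidates E V (\<lambda>w. w = u) 0))"
    proof -
      let ?X = "candidates E V (\<lambda>w. w = u) 0"
      have "card ?X * ?n \<le> (\<Sum>w\<in>?X. 2 * conflicts E V (\<lambda>w. w = u) w)"
        by (rule sum_bounded_below[where K = ?n and A = ?X, simplified])
          (simp add: candidates_def)
      also have "\<dots> \<le> (\<Sum>w\<in>V. 2 * conflicts E V (\<lambda>w. w = u) w)"
        using fin by (intro sum_mono2) (auto simp: candidates_def)
      also have "\<dots> \<le> 2 * k"
        using \<open>good_clustering E V k (\<lambda>w. w = u)\<close>
        unfolding good_clustering_def total_conflicts_def by (simp add: sum_distrib_left[symmetric])
      finally show ?thesis unfolding admissible_def by simp
    qed
    ultimately have "search_succeeds E V k (\<lambda>w. w = u) 0"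
      unfolding search_succeeds_def by (intro conjI exI[of _ "{}"]) auto
    then show ?thesis using u(1) by blast
  next
    case False
    define v where "v = arg_min_on (conflicts E V \<sigma>) V"
    have v: "v \<in> V" "\<And>u. u \<in> V \<Longrightarrow> conflicts E V \<sigma> v \<le> conflicts E V \<sigma> u"
      unfolding v_def using fin ne by (auto intro: arg_min_if_finite arg_min_least)
    define D where "D = {w\<in>V. conflict E \<sigma> v w}"
    define d where "d = card D"
    have d: "conflicts E V \<sigma> v = d"
      unfolding d_def D_def conflicts_def using fin by (simp add: of_bool_def sum.If_cases Int_def)
    have DV: "D \<subseteq> V" unfolding D_def by blast
    let ?\<tau> = "\<lambda>u. u = v \<or> E v u"
    let ?X = "candidates E V ?\<tau> d"
    \<comment> \<open>Flipping the conflicts of \<open>v\<close> turns its closed neighbourhood into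
      its cluster, so the result is \<open>\<sigma>\<close> or its complement, depending on
      \<open>\<sigma> v\<close>.\<close>
    have flip: "flip D ?\<tau> w = (\<sigma> v = \<sigma> w)" if "w \<in> V" for w
      using that unfolding flip_def D_def conflict_def by auto
    have good_flip: "good_clustering E V k (flip D ?\<tau>)"
      by (rule good_clustering_cong[OF _ gs]) (use flip in auto)
    have "conflicts E V (flip D ?\<tau>) u = conflicts E V \<sigma> u" if "u \<in> V" for u
      unfolding conflicts_def conflict_def using flip that
      by (intro sum.cong refl arg_cong[where f = of_bool]) auto
    then have cf: "int (conflicts E V \<sigma> u) =
      (if u \<in> D then int ?n - d - conflicts E V ?\<tau> u + 2 * conflicts E D ?\<tau> u
       else int (conflicts E V ?\<tau> u) + d - 2 * conflicts E D ?\<tau> u)" if "u \<in> V" for u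
      using conflicts_flip[OF fin DV, of E ?\<tau> u] that unfolding d_def by simp
    have cD: "conflicts E D ?\<tau> u \<le> d" for u
      unfolding conflicts_def d_def using sum_bounded_above[of D "\<lambda>w. of_bool (conflict E ?\<tau> u w)" "1 :: nat"]
      by simp
    have sub: "D \<subseteq> ?X"
    proof
      fix u assume u: "u \<in> D"
      then have "u \<in> V" using DV by blast
      \<comment> \<open>A flipped vertex has at least n - d minus its conflicts in
        \<open>?\<tau>\<close> as conflicts in \<open>\<sigma>\<close>. Fewer than n/2 conflicts in
        \<open>\<sigma>\<close> therefore force more than n/2 - d in \<open>?\<tau>\<close>.\<close>
      moreover have "2 * conflicts E V \<sigma> u < ?n" using False \<open>u \<in> V\<close> by auto
      ultimately show "u \<in> ?X" using cf[OF \<open>u \<in> V\<close>] u unfolding candidates_def by simp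
    qed
    have finX: "finite ?X" using fin unfolding candidates_def by simp
    \<comment> \<open>Outside \<open>D\<close> the flip removes at most \<open>d\<close> conflicts,
      which leaves twice the number at n - 4 d or more. If the truncated term is 0, the minimality
      of \<open>v\<close> supplies \<open>2 * d\<close>.\<close>
    have outside: "2 * d + (?n - 6 * d) \<le> 2 * conflicts E V \<sigma> u" if "u \<in> ?X - D" for u
    proof -
      have u: "u \<in> V" "u \<notin> D" "?n \<le> 2 * conflicts E V ?\<tau> u + 2 * d"
        using that unfolding candidates_def by auto
      show ?thesis using cf[OF u(1)] u(2,3) cD[of u] v(2)[OF u(1)] d by simp
    qed
    have XV: "?X - D \<subseteq> V" unfolding candidates_def by auto
    have "2 * (d * ?n) + (card ?X - d) * (?n - 6 * d) =
        (\<Sum>u\<in>V. 2 * d + (if u \<in> ?X - D then ?n - 6 * d else 0))"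
      using fin XV finX finite_subset[OF DV fin] sub
      by (simp add: sum.distrib sum.If_cases Int_absorb1 card_Diff_subset d_def
          del: Diff_iff)
    also have "\<dots> \<le> (\<Sum>u\<in>V. 2 * conflicts E V \<sigma> u)"
      using outside v(2) d by (intro sum_mono) auto
    also have "\<dots> \<le> 2 * k"
      using gs unfolding good_clustering_def total_conflicts_def by (simp add: sum_distrib_left[symmetric])
    finally have "admissible ?n k d (card ?X)" unfolding admissible_def by auto
    then have "search_succeeds E V k ?\<tau> d"
      unfolding search_succeeds_def using sub good_flip d_def by blast
    then show ?thesis using v(1) by blast
  qed
qed

lemma good_clustering_if_search_succeeds:
  "search_succeeds E V k \<sigma> d \<Longrightarrow> \<exists>\<sigma>. good_clustering E V k \<sigma>"
  unfolding search_succeeds_def by blast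

lemma h1_eq_total_conflicts:
  assumes "pair_graph G"
  shows "h1 G ({u\<in>pverts G. \<sigma> u}, {u\<in>pverts G. \<not> \<sigma> u}) =
    total_conflicts (\<lambda>u w. (u, w) \<in> parcs G) (pverts G) \<sigma>"
proof -
  interpret pair_graph G by fact
  have sym: "(u, w) \<in> parcs G \<longleftrightarrow> (w, u) \<in> parcs G" for u w
    using arcs_symmetric by blast
  have "in_conflict G ({u\<in>pverts G. \<sigma> u}, {u\<in>pverts G. \<not> \<sigma> u}) u v \<longleftrightarrow>
      conflict (\<lambda>u w. (u, w) \<in> parcs G) \<sigma> v u" if "u \<in> pverts G" "v \<in> pverts G" for u v
    using that sym[of u v] unfolding in_conflict_def conflict_def same_cluster_def different_clusters_def
    by auto
  then have "conflict_number G ({u\<in>pverts G. \<sigma> u}, {u\<in>pverts G. \<not> \<sigma> u}) v =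
      conflicts (\<lambda>u w. (u, w) \<in> parcs G) (pverts G) \<sigma> v" if "v \<in> pverts G" for v
    using that unfolding conflict_number_def conflicts_def
    by (simp add: of_bool_def sum.If_cases Int_def cong: conj_cong)
  then show ?thesis unfolding h1_def total_conflicts_def by simp
qed

lemma min_sum_2_clustering_iff:
  assumes "pair_graph G"
  shows "min_sum_2_clustering G k \<longleftrightarrow>
    (\<exists>\<sigma>. good_clustering (\<lambda>u w. (u, w) \<in> parcs G) (pverts G) k \<sigma>)"
proof
  assume "min_sum_2_clustering G k"
  then obtain V1 V2 where V: "V1 \<inter> V2 = {}" "V1 \<union> V2 = pverts G" "V1 \<noteq> {}" "V2 \<noteq> {}" "h1 G (V1, V2) \<le> k"
    unfolding min_sum_2_clustering_def two_partition_def by auto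
  have e: "V1 = {u\<in>pverts G. u \<in> V1}" "V2 = {u\<in>pverts G. u \<notin> V1}" using V by auto
  have "h1 G ({u\<in>pverts G. u \<in> V1}, {u\<in>pverts G. u \<notin> V1}) \<le> k" using V(5) e by simp
  then have "good_clustering (\<lambda>u w. (u, w) \<in> parcs G) (pverts G) k (\<lambda>u. u \<in> V1)"
    using V e unfolding good_clustering_def nontrivial_def h1_eq_total_conflicts[OF assms] by blast
  then show "\<exists>\<sigma>. good_clustering (\<lambda>u w. (u, w) \<in> parcs G) (pverts G) k \<sigma>" by blast
next
  assume "\<exists>\<sigma>. good_clustering (\<lambda>u w. (u, w) \<in> parcs G) (pverts G) k \<sigma>"
  then obtain \<sigma> where \<sigma>: "good_clustering (\<lambda>u w. (u, w) \<in> parcs G) (pverts G) k \<sigma>" ..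
  show "min_sum_2_clustering G k" unfolding min_sum_2_clustering_def
    using \<sigma> h1_eq_total_conflicts[OF assms, of \<sigma>]
    by (intro exI[of _ "{u\<in>pverts G. \<sigma> u}"] exI[of _ "{u\<in>pverts G. \<not> \<sigma> u}"])
      (auto simp: two_partition_def good_clustering_def nontrivial_def)
qed

section \<open>The number of flips to be tried\<close>

text \<open>Weight the j-th term by y^(d - j), which is at least 1 for j <= d, then extend the sum
  to all j <= N and apply the binomial theorem. The parameter \<open>y\<close> is left to the
  caller.\<close>

lemma sum_binomial_le:
  fixes y :: real
  assumes "1 \<le> y"
  shows "real (\<Sum>j\<le>d. N choose j) \<le> y ^ d * (1 + 1 / y) ^ N"
proof -
  have "(\<Sum>j\<le>d. N choose j) = (\<Sum>j\<in>{..d} \<inter> {..N}. N choose j)"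
    by (intro sum.mono_neutral_right) (auto simp: binomial_eq_0)
  then have "real (\<Sum>j\<le>d. N choose j) = (\<Sum>j\<in>{..d} \<inter> {..N}. real (N choose j))" by simp
  also have "\<dots> \<le> (\<Sum>j\<in>{..d} \<inter> {..N}. real (N choose j) * (y ^ d * (1 / y) ^ j))"
  proof (rule sum_mono)
    fix j assume "j \<in> {..d} \<inter> {..N}"
    then have "y ^ d * (1 / y) ^ j = y ^ (d - j)"
      using assms by (simp add: power_diff power_divide)
    moreover have "1 \<le> y ^ (d - j)" using assms by simp
    ultimately show "real (N choose j) \<le> real (N choose j) * (y ^ d * (1 / y) ^ j)"
      using mult_left_mono[of 1 "y ^ (d - j)" "real (N choose j)"] by simp
  qed
  also have "\<dots> \<le> (\<Sum>j\<le>N. real (N choose j) * (y ^ d * (1 / y) ^ j))"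
    using assms by (intro sum_mono2) auto
  also have "\<dots> = y ^ d * (1 / y + 1) ^ N"
    by (simp add: binomial_ring sum_distrib_left mult_ac)
  finally show ?thesis by (simp add: add.commute)
qed

text \<open>Any increase of the base absorbs a polynomial. The cube stands for one factor r + 1 for
  the rounds and two factors N + 1 for a test.\<close>

lemma polynomial_times_exponential_le:
  fixes a b :: real
  assumes "0 < a" "a < b"
  shows "\<exists>C>0. \<forall>x\<ge>0. (2 * x + 1) ^ 3 * a powr x \<le> C * b powr x"
proof -
  define \<epsilon> where "\<epsilon> = ln (b / a)"
  have \<epsilon>: "\<epsilon> > 0" using assms unfolding \<epsilon>_def by simp
  \<comment> \<open>Cubing \<open>2 * x + 1 \<le> M * exp (2 * x / M)\<close> costs
    \<open>exp (6 / M * x)\<close>, and \<open>M\<close> makes \<open>6 / M\<close> at most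
    \<open>\<epsilon>\<close>, the logarithm of the ratio of the bases.\<close>
  define M where "M = max 1 (6 / \<epsilon>)"
  have M: "M \<ge> 1" "6 / M \<le> \<epsilon>" using \<epsilon> unfolding M_def by (auto simp: field_simps max_def)
  have "(2 * x + 1) ^ 3 * a powr x \<le> M ^ 3 * b powr x" if x: "x \<ge> 0" for x
  proof -
    have "2 * x + 1 \<le> M * (1 + 2 * x / M)" using M x by (simp add: field_simps)
    also have "\<dots> \<le> M * exp (2 * x / M)" using M by (intro mult_left_mono exp_ge_add_one_self) auto
    finally have "(2 * x + 1) ^ 3 \<le> (M * exp (2 * x / M)) ^ 3" using x by (intro power_mono) auto
    also have "\<dots> = M ^ 3 * exp (6 / M * x)"
      by (simp add: power_mult_distrib exp_of_nat_mult[symmetric])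
    also have "\<dots> \<le> M ^ 3 * exp (\<epsilon> * x)"
      using M x mult_right_mono[of "6 / M" \<epsilon> x] by (intro mult_left_mono) auto
    finally have "(2 * x + 1) ^ 3 * a powr x \<le> M ^ 3 * (exp (\<epsilon> * x) * a powr x)"
      using mult_right_mono[of "(2 * x + 1) ^ 3" "M ^ 3 * exp (\<epsilon> * x)" "a powr x"] by (simp add: mult.assoc)
    also have "exp (\<epsilon> * x) * a powr x = b powr x"
      using assms unfolding \<epsilon>_def
      by (simp add: powr_def exp_add[symmetric] ln_div algebra_simps)
    finally show ?thesis .
  qed
  then show ?thesis using M by (intro exI[of _ "M ^ 3"]) auto
qed

definition search_exponent :: "nat \<Rightarrow> nat \<Rightarrow> real" where
  "search_exponent n k = (let r = real k / real n in r / (1 - 4 * r / real n))"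

lemma search_exponent_eq:
  assumes "0 < n"
  shows "search_exponent n k = real k * real n / ((real n)\<^sup>2 - 4 * real k)"
  using assms unfolding search_exponent_def Let_def
  by (simp add: divide_simps power2_eq_square)

lemma rate_le_search_exponent:
  assumes "0 < n" "4 * real k < (real n)\<^sup>2"
  shows "real k / real n \<le> search_exponent n k"
  using assms unfolding search_exponent_eq[OF assms(1)]
  by (simp add: field_simps power2_eq_square)

text \<open>If d < N, solving \<open>admissible\<close> for N + d gives 2 (k - 6 d^2) / (n - 6 d).
  After clearing denominators, the gap between half of this and the exponent is 2 (k - d n) (2 k - d
  n) + 4 d^2 (n^2 - 6 k), which is nonnegative as d n <= k and 6 k < n^2.\<close>

lemma candidates_plus_flips_le:
  assumes n: "0 < n" and k: "6 * real k < (real n)\<^sup>2" and adm: "admissible n k d N"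
  shows "real N + real d \<le> 2 * search_exponent n k"
proof -
  have dk: "real d * real n \<le> real k" using adm unfolding admissible_def
    by (metis of_nat_le_iff of_nat_mult)
  have n0: "real n > 0" using n by simp
  have k4: "4 * real k < (real n)\<^sup>2" using k by linarith
  show ?thesis
  proof (cases "N \<le> d")
    case True
    have "real d \<le> real k / real n" using dk n0 by (simp add: field_simps)
    then show ?thesis using True rate_le_search_exponent[OF n k4] by simp
  next
    case False
    have "6 * real d * real n < real n * real n"
      using dk k by (simp add: power2_eq_square)
    then have nd: "6 * real d < real n" using n0 by simp
    have "real ((N - d) * (n - 6 * d)) \<le> real (2 * (k - d * n))"
      using adm unfolding admissible_def by linarith
    then have "(real N - real d) * (real n - 6 * real d) \<le> 2 * (real k - real d * real n)"
      using False nd dk adm unfolding admissible_def by (simp add: of_nat_diff)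
    then have "real N - real d \<le> 2 * (real k - real d * real n) / (real n - 6 * real d)"
      using nd by (simp add: field_simps)
    then have "real N + real d \<le> 2 * (real k - 6 * (real d)\<^sup>2) / (real n - 6 * real d)"
      using nd by (simp add: field_simps power2_eq_square)
    also have "\<dots> \<le> 2 * search_exponent n k"
    proof -
      have "0 \<le> 2 * ((real k - real d * real n) * (2 * real k - real d * real n))"
        using dk by (intro mult_nonneg_nonneg) auto
      moreover have "(real d)\<^sup>2 * (6 * real k) \<le> (real d)\<^sup>2 * (real n)\<^sup>2"
        using k by (intro mult_left_mono) auto
      ultimately have "(real k - 6 * (real d)\<^sup>2) * ((real n)\<^sup>2 - 4 * real k)
          \<le> real k * real n * (real n - 6 * real d)"
        by (simp add: algebra_simps power2_eq_square)
      then have "(real k - 6 * (real d)\<^sup>2) / (real n - 6 * real d) \<le> search_exponent n k"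
        unfolding search_exponent_eq[OF n] using k4 nd by (simp add: divide_simps mult.commute)
      then show ?thesis unfolding times_divide_eq_right[symmetric] by linarith
    qed
    finally show ?thesis .
  qed
qed

text \<open>As a function of r the exponent is r n / (n - 4 r), with value n/2 and slope 9 at r =
  n/6. With denominators cleared, the gap to the tangent is the square of n^2 - 6 k.\<close>

lemma search_exponent_ge_tangent:
  assumes "0 < n" "4 * real k < (real n)\<^sup>2"
  shows "9 * (real k / real n) - real n \<le> search_exponent n k"
proof -
  have "0 \<le> (6 * real k - real n * real n)\<^sup>2" by simp
  then show ?thesis using assms unfolding search_exponent_eq[OF assms(1)]
    by (simp add: divide_simps power2_eq_square algebra_simps)
qed

text \<open>
  For \<open>6 k < n\<^sup>2\<close> the candidates and flips together number at most twice the exponent, and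
  \<open>1.6182\<close> is a rational upper bound of the golden ratio whose square is below \<open>2.619\<close>, which leaves
  room for the polynomial factors.  For larger \<open>k\<close> the trivial bound \<open>N \<le> n\<close> suffices, because
  the exponent lies above its tangent \<open>9 r - n\<close> at \<open>r = n / 6\<close>.
\<close>

theorem search_size_bound:
  "\<exists>C>0. \<forall>n k d N. 0 < n \<longrightarrow> 4 * real k < (real n)\<^sup>2 \<longrightarrow> N \<le> n \<longrightarrow> admissible n k d N \<longrightarrow>
     (real k / real n + 1) * (real N + 1)\<^sup>2 * real (\<Sum>j\<le>d. N choose j)
       \<le> C * 2.619 powr search_exponent n k"
proof -
  define \<phi> :: real where "\<phi> = 1.6182"
  obtain C1 where C1: "C1 > 0" "\<And>x. x \<ge> 0 \<Longrightarrow> (2 * x + 1) ^ 3 * (\<phi>\<^sup>2) powr x \<le> C1 * 2.619 powr x"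
    using polynomial_times_exponential_le[of "\<phi>\<^sup>2" "2.619"] unfolding \<phi>_def
    by (auto simp: power2_eq_square)
  \<comment> \<open>1.575 = 1.26 * 1.25, where 1.26 bounds \<open>4 powr (1 / 6)\<close> and 1.25 =
    1 + 1/4 belongs to y = 4. The base 1.6 satisfies 1.6^2 = 2.56 < 2.619, so
    \<open>1.6 powr n\<close> fits under \<open>2.619 powr (n / 2)\<close>.\<close>
  obtain C2 where C2: "C2 > 0" "\<And>x :: real. x \<ge> 0 \<Longrightarrow> (2 * x + 1) ^ 3 * 1.575 powr x \<le> C2 * 1.6 powr x"
    using polynomial_times_exponential_le[of "1.575" "1.6"] by auto
  have "(real k / real n + 1) * (real N + 1)\<^sup>2 * real (\<Sum>j\<le>d. N choose j)
       \<le> max C1 C2 * 2.619 powr search_exponent n k"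
    if n: "0 < n" and k: "4 * real k < (real n)\<^sup>2" and N: "N \<le> n" and adm: "admissible n k d N" for n k d N
  proof -
    define r where "r = real k / real n"
    define x where "x = search_exponent n k"
    have rx: "r \<le> x" using rate_le_search_exponent[OF n k] unfolding r_def x_def .
    have r0: "0 \<le> r" unfolding r_def by simp
    have "real d * real n \<le> real k" using adm unfolding admissible_def
      by (metis of_nat_le_iff of_nat_mult)
    then have dr: "real d \<le> r" using n unfolding r_def by (simp add: field_simps)
    show ?thesis
    proof (cases "6 * real k < (real n)\<^sup>2")
      case True
      have Nx: "real N + real d \<le> 2 * x"
        using candidates_plus_flips_le[OF n True adm] unfolding x_def .
      have "real (\<Sum>j\<le>d. N choose j) \<le> \<phi> ^ d * (1 + 1 / \<phi>) ^ N"
        by (rule sum_binomial_le) (simp add: \<phi>_def)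
      also have "\<dots> \<le> \<phi> ^ d * \<phi> ^ N"
        by (intro mult_left_mono power_mono) (auto simp: \<phi>_def)
      also have "\<dots> = \<phi> powr (real N + real d)"
        by (simp add: powr_add powr_realpow \<phi>_def)
      also have "\<dots> \<le> \<phi> powr (2 * x)" using Nx by (intro powr_mono) (auto simp: \<phi>_def)
      also have "\<dots> = (\<phi>\<^sup>2) powr x"
        by (simp add: powr_powr[symmetric] \<phi>_def)
      finally have count: "real (\<Sum>j\<le>d. N choose j) \<le> (\<phi>\<^sup>2) powr x" .
      have "(r + 1) * (real N + 1)\<^sup>2 \<le> (2 * x + 1) * (2 * x + 1)\<^sup>2"
        using rx r0 Nx by (intro mult_mono power_mono) auto
      then have "(r + 1) * (real N + 1)\<^sup>2 * real (\<Sum>j\<le>d. N choose j) \<le> (2 * x + 1) ^ 3 * (\<phi>\<^sup>2) powr x"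
        using count rx r0 by (intro mult_mono) (auto simp: power3_eq_cube power2_eq_square intro: sum_nonneg)
      also have "\<dots> \<le> C1 * 2.619 powr x" using C1(2) rx r0 by simp
      also have "\<dots> \<le> max C1 C2 * 2.619 powr x" by (intro mult_right_mono) auto
      finally show ?thesis unfolding r_def x_def .
    next
      case False
      \<comment> \<open>The excess of r over the point of tangency n/6. In terms of it the tangent
        is n/2 + 9 e, so the factor \<open>4 powr e\<close> from d <= n/6 + e is paid for by 4 <=
        2.619^9.\<close>
      define e where "e = r - real n / 6"
      have e0: "0 \<le> e" using False n unfolding e_def r_def by (simp add: field_simps power2_eq_square)
      have rn: "r \<le> real n" using k n unfolding r_def by (simp add: field_simps power2_eq_square)
      have "real (\<Sum>j\<le>d. N choose j) \<le> 4 ^ d * (1 + 1 / 4) ^ N"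
        by (rule sum_binomial_le) simp
      also have "\<dots> \<le> 4 powr r * 1.25 powr real n"
        using dr N by (intro mult_mono) (auto simp: powr_realpow[symmetric] intro!: powr_mono)
      also have "4 powr r = (4 powr (1 / 6)) powr real n * 4 powr e"
        unfolding e_def powr_powr by (simp add: powr_add[symmetric])
      finally have count4: "real (\<Sum>j\<le>d. N choose j)
          \<le> (4 powr (1 / 6)) powr real n * 4 powr e * 1.25 powr real n" .
      have "4 powr (1 / 6) \<le> (1.26 :: real)"
      proof -
        have "(4 :: real) powr (1 / 6) \<le> (1.26 ^ 6) powr (1 / 6)"
          by (intro powr_mono2) (auto simp: eval_nat_numeral)
        also have "(1.26 ^ 6) powr (1 / 6) = (1.26 :: real)"
          by (subst powr_realpow[symmetric]) (simp, simp add: powr_powr del: powr_numeral)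
        finally show ?thesis .
      qed
      moreover have "(4 :: real) \<le> 2.619 ^ 9" by (simp add: eval_nat_numeral)
      ultimately have "(4 powr (1 / 6)) powr real n * 4 powr e * 1.25 powr real n
          \<le> 1.26 powr real n * (2.619 powr 9) powr e * 1.25 powr real n"
        using e0 by (intro mult_right_mono mult_mono powr_mono2) auto
      also have "\<dots> = 1.575 powr real n * 2.619 powr (9 * e)"
      proof -
        have "(1.26 :: real) powr real n * 1.25 powr real n = 1.575 powr real n"
          by (subst powr_mult[symmetric]) auto
        moreover have "((2.619 :: real) powr 9) powr e = 2.619 powr (9 * e)" by (rule powr_powr)
        moreover have "a * c * b = a * b * c" for a b c :: real by simp
        ultimately show ?thesis by (simp only:)
      qed
      finally have count: "real (\<Sum>j\<le>d. N choose j) \<le> 1.575 powr real n * 2.619 powr (9 * e)"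
        using count4 by (rule order.trans[rotated])
      have "(r + 1) * (real N + 1)\<^sup>2 \<le> (2 * real n + 1) * (2 * real n + 1)\<^sup>2"
        using rn r0 N by (intro mult_mono power_mono) auto
      then have "(r + 1) * (real N + 1)\<^sup>2 * real (\<Sum>j\<le>d. N choose j)
          \<le> (2 * real n + 1) ^ 3 * (1.575 powr real n * 2.619 powr (9 * e))"
        using count by (intro mult_mono) (auto simp: power3_eq_cube power2_eq_square intro: sum_nonneg)
      also have "\<dots> = ((2 * real n + 1) ^ 3 * 1.575 powr real n) * 2.619 powr (9 * e)" by simp
      also have "\<dots> \<le> (C2 * 1.6 powr real n) * 2.619 powr (9 * e)"
        using C2(2)[of "real n"] by (intro mult_right_mono) auto
      also have "\<dots> \<le> (max C1 C2 * 2.619 powr (real n / 2)) * 2.619 powr (9 * e)"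
      proof -
        have "(1.6 :: real) powr real n = (1.6 powr 2) powr (real n / 2)" by (subst powr_powr) simp
        also have "\<dots> \<le> 2.619 powr (real n / 2)" by (intro powr_mono2) (auto simp: power2_eq_square)
        finally show ?thesis using C1(1) C2(1) by (intro mult_right_mono mult_mono) auto
      qed
      also have "\<dots> = max C1 C2 * 2.619 powr (9 * r - real n)"
        unfolding e_def by (simp add: powr_add[symmetric])
      also have "\<dots> \<le> max C1 C2 * 2.619 powr x"
        using search_exponent_ge_tangent[OF n k] C1(1) unfolding r_def x_def
        by (intro mult_left_mono powr_mono) auto
      finally show ?thesis unfolding r_def x_def .
    qed
  qed
  then show ?thesis using C1(1) by (intro exI[of _ "max C1 C2"]) auto
qed

section \<open>Total correctness with running time\<close>

text \<open>The existence of a run includes termination and the absence of overflow. Since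
  \<open>Q\<close> also receives the time, the equations below turn straight-line code into
  arithmetic by simplification.\<close>

definition exec :: "nat \<Rightarrow> prog \<Rightarrow> store \<Rightarrow> (nat \<Rightarrow> store \<Rightarrow> bool) \<Rightarrow> bool" where
  "exec W p s Q \<longleftrightarrow> (\<exists>t s'. run W p s t s' \<and> Q t s')"

lemma exec_Skip [simp]: "exec W Skip s Q \<longleftrightarrow> Q 1 s"
  unfolding exec_def using run.Skip[of W s] by (auto elim: run.cases)

lemma exec_Write [simp]:
  "exec W (Write a i e) s Q \<longleftrightarrow> eval_expr i s < W \<and> eval_expr e s < W \<and>
     Q (1 + expr_cost i + expr_cost e) (s(a := (s a)(eval_expr i s := eval_expr e s)))"
  (is "_ \<longleftrightarrow> ?R")
proof
  assume "exec W (Write a i e) s Q"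
  then obtain t s' where "run W (Write a i e) s t s'" "Q t s'" unfolding exec_def by blast
  then show ?R by cases auto
next
  assume ?R
  then show "exec W (Write a i e) s Q" unfolding exec_def using run.Write[of i s W e a] by blast
qed

lemma exec_Seq [simp]:
  "exec W (Seq p q) s Q \<longleftrightarrow> exec W p s (\<lambda>t s'. exec W q s' (\<lambda>t'. Q (t + t')))"
  unfolding exec_def
proof safe
  fix t s' assume "run W (Seq p q) s t s'" "Q t s'"
  then show "\<exists>t s'. run W p s t s' \<and> (\<exists>t' s''. run W q s' t' s'' \<and> Q (t + t') s'')"
    by cases auto
qed (auto intro: run.Seq)

lemma exec_Cond [simp]:
  "exec W (Cond b p q) s Q \<longleftrightarrow>
     (if eval_expr b s \<noteq> 0 then exec W p s (\<lambda>t. Q (1 + expr_cost b + t))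
      else exec W q s (\<lambda>t. Q (1 + expr_cost b + t)))"
proof -
  have "exec W (Cond b p q) s Q" if "eval_expr b s \<noteq> 0" "exec W p s (\<lambda>t. Q (1 + expr_cost b + t))"
    using that unfolding exec_def by (blast intro: run.CondTrue)
  moreover have "exec W (Cond b p q) s Q"
    if "eval_expr b s = 0" "exec W q s (\<lambda>t. Q (1 + expr_cost b + t))"
    using that unfolding exec_def by (blast intro: run.CondFalse)
  moreover have "if eval_expr b s \<noteq> 0 then exec W p s (\<lambda>t. Q (1 + expr_cost b + t))
      else exec W q s (\<lambda>t. Q (1 + expr_cost b + t))" if ex: "exec W (Cond b p q) s Q"
  proof -
    from ex obtain t s' where "run W (Cond b p q) s t s'" "Q t s'" unfolding exec_def by blast
    then show ?thesis unfolding exec_def by cases auto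
  qed
  ultimately show ?thesis by (auto split: if_splits)
qed

fun writes :: "prog \<Rightarrow> nat set" where
  "writes Skip = {}"
| "writes (Write a i e) = {a}"
| "writes (Seq p q) = writes p \<union> writes q"
| "writes (Cond b p q) = writes p \<union> writes q"
| "writes (Loop b p) = writes p"

lemma run_frame: "run W p s t s' \<Longrightarrow> a \<notin> writes p \<Longrightarrow> s' a = s a"
  by (induction rule: run.induct) auto

text \<open>The new postcondition may assume that all arrays outside \<open>writes p\<close> are
  unchanged, so specifications need to list only what changes.\<close>

lemma exec_conseq:
  assumes "exec W p s P"
    and "\<And>t s'. P t s' \<Longrightarrow> \<forall>a. a \<notin> writes p \<longrightarrow> s' a = s a \<Longrightarrow> Q t s'"
  shows "exec W p s Q"
  using assms run_frame unfolding exec_def by metis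

text \<open>The drop of \<open>\<Phi>\<close> pays for body and test, so it is termination measure
  and time bound at once. This suits loops whose number of iterations is bounded by amortisation,
  such as the subset enumeration.\<close>

lemma exec_potential_loop:
  assumes init: "I s"
    and step: "\<And>s'. I s' \<Longrightarrow> \<forall>a. a \<notin> writes p \<longrightarrow> s' a = s a \<Longrightarrow> eval_expr b s' \<noteq> 0 \<Longrightarrow>
      exec W p s' (\<lambda>t s''. I s'' \<and> \<Phi> s'' + t + 1 + expr_cost b \<le> \<Phi> s')"
    and post: "\<And>t s'. I s' \<Longrightarrow> \<forall>a. a \<notin> writes p \<longrightarrow> s' a = s a \<Longrightarrow> eval_expr b s' = 0 \<Longrightarrow>
      t \<le> \<Phi> s + 1 + expr_cost b \<Longrightarrow> Q t s'"
  shows "exec W (Loop b p) s Q"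
proof -
  have "\<exists>t s''. run W (Loop b p) s' t s'' \<and> I s'' \<and> eval_expr b s'' = 0 \<and> t \<le> \<Phi> s' + 1 + expr_cost b"
    if "I s'" "\<forall>a. a \<notin> writes p \<longrightarrow> s' a = s a" for s'
    using that
  proof (induction "\<Phi> s'" arbitrary: s' rule: less_induct)
    case less
    show ?case
    proof (cases "eval_expr b s' = 0")
      case True
      with less.prems show ?thesis using run.LoopFalse[OF True, of W p] by fastforce
    next
      case False
      from step[OF less.prems False] obtain t s'' where
        1: "run W p s' t s''" "I s''" "\<Phi> s'' + t + 1 + expr_cost b \<le> \<Phi> s'"
        unfolding exec_def by blast
      have "\<forall>a. a \<notin> writes p \<longrightarrow> s'' a = s a"
        using less.prems(2) run_frame[OF 1(1)] by simp
      moreover have "\<Phi> s'' < \<Phi> s'" using 1(3) by simp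
      ultimately obtain t' s3 where
        2: "run W (Loop b p) s'' t' s3" "I s3" "eval_expr b s3 = 0" "t' \<le> \<Phi> s'' + 1 + expr_cost b"
        using less.hyps[of s''] 1(2) by blast
      have "run W (Loop b p) s' (1 + expr_cost b + t + t') s3"
        using run.LoopTrue[OF False 1(1) 2(1)] .
      moreover have "1 + expr_cost b + t + t' \<le> \<Phi> s' + 1 + expr_cost b"
        using 1(3) 2(4) by linarith
      ultimately show ?thesis using 2 by blast
    qed
  qed
  from this[OF init] obtain t s'' where
    r: "run W (Loop b p) s t s''" "I s''" "eval_expr b s'' = 0" "t \<le> \<Phi> s + 1 + expr_cost b"
    by auto
  with post[OF r(2)] run_frame[OF r(1)] show ?thesis unfolding exec_def by auto
qed

lemma exec_for_sum:
  assumes init: "I 0 s"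
    and step: "\<And>j s'. j < m \<Longrightarrow> I j s' \<Longrightarrow> \<forall>a. a \<notin> writes p \<longrightarrow> s' a = s a \<Longrightarrow>
      eval_expr b s' \<noteq> 0 \<and> exec W p s' (\<lambda>t s''. t \<le> K j \<and> I (Suc j) s'')"
    and fin: "\<And>s'. I m s' \<Longrightarrow> \<forall>a. a \<notin> writes p \<longrightarrow> s' a = s a \<Longrightarrow> eval_expr b s' = 0"
    and post: "\<And>t s'. I m s' \<Longrightarrow> \<forall>a. a \<notin> writes p \<longrightarrow> s' a = s a \<Longrightarrow>
      t \<le> (\<Sum>j<m. K j + 1 + expr_cost b) + 1 + expr_cost b \<Longrightarrow> Q t s'"
  shows "exec W (Loop b p) s Q"
proof -
  have "\<exists>t s''. run W (Loop b p) s' t s'' \<and> I m s'' \<and>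
      t \<le> (\<Sum>j\<in>{i..<m}. K j + 1 + expr_cost b) + 1 + expr_cost b"
    if "i \<le> m" "I i s'" "\<forall>a. a \<notin> writes p \<longrightarrow> s' a = s a" for i s'
    using that
  proof (induction i arbitrary: s' rule: inc_induct)
    case base
    then show ?case using run.LoopFalse[OF fin[OF base]] by fastforce
  next
    case (step i)
    from assms(2)[OF step.hyps(2) step.prems] obtain t s'' where
      1: "eval_expr b s' \<noteq> 0" "run W p s' t s''" "t \<le> K i" "I (Suc i) s''"
      unfolding exec_def by blast
    have "\<forall>a. a \<notin> writes p \<longrightarrow> s'' a = s a"
      using step.prems(2) run_frame[OF 1(2)] by simp
    from step.IH[OF 1(4) this] obtain t' s3 where
      2: "run W (Loop b p) s'' t' s3" "I m s3"
        "t' \<le> (\<Sum>j\<in>{Suc i..<m}. K j + 1 + expr_cost b) + 1 + expr_cost b" by blast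
    have "run W (Loop b p) s' (1 + expr_cost b + t + t') s3"
      using run.LoopTrue[OF 1(1,2) 2(1)] .
    moreover have "1 + expr_cost b + t + t' \<le> (\<Sum>j\<in>{i..<m}. K j + 1 + expr_cost b) + 1 + expr_cost b"
      using 1(3) 2(3) by (simp only: sum.atLeast_Suc_lessThan[OF step.hyps(2)])
    ultimately show ?case using 2(2) by blast
  qed
  from this[of 0 s] init obtain t s'' where
    r: "run W (Loop b p) s t s''" "I m s''" "t \<le> (\<Sum>j<m. K j + 1 + expr_cost b) + 1 + expr_cost b"
    by (auto simp: atLeast0LessThan)
  with post[OF r(2)] run_frame[OF r(1)] show ?thesis unfolding exec_def by auto
qed

lemma exec_for:
  assumes "I 0 s"
    and "\<And>j s'. j < m \<Longrightarrow> I j s' \<Longrightarrow> \<forall>a. a \<notin> writes p \<longrightarrow> s' a = s a \<Longrightarrow>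
      eval_expr b s' \<noteq> 0 \<and> exec W p s' (\<lambda>t s''. t \<le> K \<and> I (Suc j) s'')"
    and "\<And>s'. I m s' \<Longrightarrow> \<forall>a. a \<notin> writes p \<longrightarrow> s' a = s a \<Longrightarrow> eval_expr b s' = 0"
    and post: "\<And>t s'. I m s' \<Longrightarrow> \<forall>a. a \<notin> writes p \<longrightarrow> s' a = s a \<Longrightarrow>
      t \<le> m * (K + 1 + expr_cost b) + 1 + expr_cost b \<Longrightarrow> Q t s'"
  shows "exec W (Loop b p) s Q"
  by (rule exec_for_sum[where I = I and K = "\<lambda>_. K", OF assms(1-3)]) (auto intro!: post)

abbreviation var :: "nat \<Rightarrow> expr" where "var a \<equiv> Read a (Const 0)"
abbreviation assign :: "nat \<Rightarrow> expr \<Rightarrow> prog" where "assign a e \<equiv> Write a (Const 0) e"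
abbreviation incr :: "nat \<Rightarrow> prog" where "incr a \<equiv> assign a (Add (var a) (Const 1))"
abbreviation less_expr :: "expr \<Rightarrow> expr \<Rightarrow> expr" where "less_expr e f \<equiv> Sub f e"
abbreviation leq_expr :: "expr \<Rightarrow> expr \<Rightarrow> expr" where "leq_expr e f \<equiv> Sub (Add f (Const 1)) e"
abbreviation neq_expr :: "expr \<Rightarrow> expr \<Rightarrow> expr" where "neq_expr e f \<equiv> Add (Sub e f) (Sub f e)"
abbreviation double :: "expr \<Rightarrow> expr" where "double e \<equiv> Add e e"

definition for_loop :: "nat \<Rightarrow> expr \<Rightarrow> prog \<Rightarrow> prog" where
  "for_loop i e p = Seq (assign i (Const 0)) (Loop (less_expr (var i) e) (Seq p (incr i)))"

lemma writes_for_loop [simp]: "writes (for_loop i e p) = insert i (writes p)"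
  unfolding for_loop_def by auto

text \<open>The increment of \<open>i\<close> follows the body, hence the invariant must be
  independent of array \<open>i\<close>; as the counter itself reaches \<open>m\<close>, the word
  bound has to exceed \<open>m\<close>. The 10 covers increment and test.\<close>

lemma exec_for_loop:
  assumes bound: "\<And>s'. \<forall>a. a \<notin> insert i (writes p) \<longrightarrow> s' a = s a \<Longrightarrow> eval_expr e s' = m"
    and i: "i \<notin> writes p" and W: "m < W"
    and indep: "\<And>j s' x. I j s' \<Longrightarrow> I j (s'(i := x))"
    and init: "I 0 s"
    and step: "\<And>j s'. j < m \<Longrightarrow> I j s' \<Longrightarrow> s' i 0 = j \<Longrightarrow>
      \<forall>a. a \<notin> insert i (writes p) \<longrightarrow> s' a = s a \<Longrightarrow> exec W p s' (\<lambda>t s''. t \<le> K \<and> I (Suc j) s'')"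
    and post: "\<And>t s'. I m s' \<Longrightarrow> \<forall>a. a \<notin> insert i (writes p) \<longrightarrow> s' a = s a \<Longrightarrow>
      t \<le> (m + 1) * (K + 10 + expr_cost e) \<Longrightarrow> Q t s'"
  shows "exec W (for_loop i e p) s Q"
proof -
  let ?s = "s(i := (s i)(0 := 0))"
  have "exec W (Loop (less_expr (var i) e) (Seq p (incr i))) ?s (\<lambda>t. Q (Suc (Suc (Suc t))))"
  proof (rule exec_for[where I = "\<lambda>j s'. I j s' \<and> s' i 0 = j" and m = m and K = "K + 6"], goal_cases)
    case 1
    show ?case using indep[OF init] by simp
  next
    case (2 j s')
    then have frame: "\<forall>a. a \<notin> insert i (writes p) \<longrightarrow> s' a = s a" by auto
    have "exec W (Seq p (incr i)) s' (\<lambda>t s''. t \<le> K + 6 \<and> I (Suc j) s'' \<and> s'' i 0 = Suc j)"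
      unfolding exec_Seq
      by (rule exec_conseq[OF step[OF 2(1) _ _ frame]]) (use 2 i W indep in auto)
    then show ?case using 2 bound[OF frame] by simp
  next
    case (3 s')
    then have "\<forall>a. a \<notin> insert i (writes p) \<longrightarrow> s' a = s a" by auto
    from bound[OF this] show ?case using 3 by simp
  next
    case (4 t s')
    then have "\<forall>a. a \<notin> insert i (writes p) \<longrightarrow> s' a = s a" by auto
    then show ?case using 4 by (intro post) (auto simp: algebra_simps)
  qed
  then show ?thesis unfolding for_loop_def using W by simp
qed

section \<open>The program\<close>

text \<open>
  Arrays: 2 answer, 3 multiples of \<open>n\<close>, 4 start vertex, 5 start clustering, 6 its conflict
  matrix, 7 its conflict numbers, 8 their sum, 9 size of the cluster marked 1, 10 and 11 loop
  counters, 12 \<open>d\<close>, 13 \<open>d n\<close>, 14 list of candidates, 15 its length \<open>N\<close>, 16 the left-hand side of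
  the condition \<open>admissible\<close>, 17 characteristic vector of the current subset of the list, 18 its
  size, 19 flag for the enumeration, 20 to 23 the sides of the tests in
  \<open>good_clustering_flip_iff\<close>, 24 bit position.
\<close>

definition mult_table :: prog where
  "mult_table = Seq (Write 3 (Const 0) (Const 0))
     (for_loop 10 (var 0) (Write 3 (Add (var 10) (Const 1)) (Add (Read 3 (var 10)) (var 0))))"

definition singleton_start :: prog where
  "singleton_start = for_loop 10 (var 0)
     (Cond (neq_expr (var 10) (var 4)) (Write 5 (var 10) (Const 0)) (Write 5 (var 10) (Const 1)))"

definition neighbourhood_start :: prog where
  "neighbourhood_start = for_loop 10 (var 0)
     (Cond (neq_expr (var 10) (var 4))
        (Write 5 (var 10) (Read 1 (Add (Read 3 (var 4)) (var 10)))) (Write 5 (var 10) (Const 1)))"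

definition conflict_row :: prog where
  "conflict_row = (let a = Add (Read 3 (var 10)) (var 11) in
     for_loop 11 (var 0)
       (Seq (Cond (neq_expr (var 10) (var 11))
          (Cond (neq_expr (Read 5 (var 10)) (Read 5 (var 11)))
             (Write 6 a (Read 1 a)) (Write 6 a (Sub (Const 1) (Read 1 a))))
          (Write 6 a (Const 0)))
       (Write 7 (var 10) (Add (Read 7 (var 10)) (Read 6 a)))))"

definition conflict_matrix :: prog where
  "conflict_matrix = Seq (assign 8 (Const 0)) (Seq (assign 9 (Const 0))
     (for_loop 10 (var 0)
       (Seq (Write 7 (var 10) (Const 0))
       (Seq (assign 9 (Add (var 9) (Read 5 (var 10))))
       (Seq conflict_row
         (assign 8 (Add (var 8) (Read 7 (var 10)))))))))"

text \<open>The product \<open>(N - d) * (n - 6 * d)\<close> is accumulated by addition: each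
  candidate found when at least \<open>d\<close> are already listed adds \<open>n - 6 * d\<close>,
  which mirrors the truncation in \<open>N - d\<close>.\<close>

definition collect_candidates :: prog where
  "collect_candidates = Seq (assign 15 (Const 0)) (Seq (assign 16 (Const 0))
    (for_loop 10 (var 0)
      (Cond (leq_expr (var 0) (double (Add (Read 7 (var 10)) (var 12))))
        (Seq (Cond (leq_expr (var 12) (var 15))
               (assign 16 (Add (var 16) (Sub (var 0) (double (Add (double (var 12)) (var 12))))))
               Skip)
        (Seq (Write 14 (var 15) (var 10)) (incr 15)))
        Skip)))"

definition test_row :: prog where
  "test_row = for_loop 11 (var 15)
     (Cond (Read 17 (var 11))
        (assign 20 (Add (var 20)
           (double (double (Read 6 (Add (Read 3 (Read 14 (var 10))) (Read 14 (var 11))))))))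
        Skip)"

text \<open>Cell 0 of array 2 is only ever set to 1 here, so the answer accumulates as a disjunction
  over all tests.\<close>

definition test_flip :: prog where
  "test_flip = Seq (assign 20 (var 8)) (Seq (assign 21 (Read 0 (Const 1)))
    (Seq (assign 22 (var 9)) (Seq (assign 23 (Const 0))
    (Seq (for_loop 10 (var 15)
      (Cond (Read 17 (var 10))
        (Seq (assign 20 (Add (var 20) (double (Sub (var 0) (var 18)))))
        (Seq (assign 21 (Add (var 21) (double (double (Read 7 (Read 14 (var 10)))))))
        (Seq (Cond (Read 5 (Read 14 (var 10))) (incr 23) (incr 22))
          test_row)))
        Skip))
    (Cond (leq_expr (var 20) (var 21))
      (Cond (less_expr (var 23) (var 22))
        (Cond (less_expr (var 22) (Add (var 0) (var 23))) (assign 2 (Const 1)) Skip) Skip) Skip)))))"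

text \<open>
  The subsets of size at most \<open>d\<close> are enumerated as a binary counter.  If the current subset has
  \<open>d\<close> elements, all counter values up to the addition of its lowest bit have more than \<open>d\<close> bits and
  are skipped.  Cell \<open>N\<close> of array 17 is a sentinel that stays 0 and stops the carry.
\<close>

definition lowest_bit :: prog where
  "lowest_bit = (let x = Sub (var 15) (Add (var 10) (Const 1)) in
     Seq (assign 24 (var 15)) (for_loop 10 (var 15) (Cond (Read 17 x) (assign 24 x) Skip)))"

definition carry :: prog where
  "carry = Loop (Read 17 (var 24))
     (Seq (Write 17 (var 24) (Const 0)) (Seq (assign 18 (Sub (var 18) (Const 1))) (incr 24)))"

definition next_subset :: prog where
  "next_subset = Seq lowest_bit (Seq (Cond (less_expr (var 18) (var 12)) (assign 24 (Const 0)) Skip)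
     (Seq carry (Cond (less_expr (var 24) (var 15))
        (Seq (Write 17 (var 24) (Const 1)) (incr 18)) (assign 19 (Const 0)))))"

definition enumerate_subsets :: prog where
  "enumerate_subsets = Seq (for_loop 10 (Add (var 15) (Const 1)) (Write 17 (var 10) (Const 0)))
     (Seq (assign 18 (Const 0)) (Seq (assign 19 (Const 1))
       (Loop (var 19) (Seq test_flip next_subset))))"

text \<open>The loop guard is the first conjunct of \<open>admissible\<close> and the
  \<open>Cond\<close> the second.\<close>

definition search :: prog where
  "search = Seq (assign 12 (Const 0)) (Seq (assign 13 (Const 0))
     (Loop (leq_expr (var 13) (Read 0 (Const 1)))
       (Seq collect_candidates
       (Seq (Cond (leq_expr (var 16) (double (Sub (Read 0 (Const 1)) (var 13)))) enumerate_subsets Skip)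
       (Seq (incr 12) (assign 13 (Add (var 13) (var 0))))))))"

definition evaluate_and_search :: prog where
  "evaluate_and_search = Seq conflict_matrix search"

definition search_from_vertex :: prog where
  "search_from_vertex = Seq singleton_start (Seq evaluate_and_search
     (Seq neighbourhood_start evaluate_and_search))"

definition clustering_prog :: prog where
  "clustering_prog = Seq mult_table (Seq (for_loop 4 (var 0) search_from_vertex) (assign 0 (var 2)))"

lemma writes_start [simp]:
  "writes mult_table = {3, 10}" "writes singleton_start = {5, 10}"
  "writes neighbourhood_start = {5, 10}" "writes conflict_row = {6, 7, 11}"
  "writes conflict_matrix = {6, 7, 8, 9, 10, 11}"
  unfolding mult_table_def singleton_start_def neighbourhood_start_def conflict_row_def
    conflict_matrix_def Let_def by auto

lemma writes_test [simp]:
  "writes collect_candidates = {10, 14, 15, 16}" "writes test_row = {11, 20}"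
  "writes test_flip = {2, 10, 11, 20, 21, 22, 23}"
  unfolding collect_candidates_def test_row_def test_flip_def by auto

lemma writes_search [simp]:
  "writes lowest_bit = {10, 24}" "writes carry = {17, 18, 24}"
  "writes next_subset = {10, 17, 18, 19, 24}"
  "writes enumerate_subsets = {2, 10, 11, 17, 18, 19, 20, 21, 22, 23, 24}"
  "writes search = {2, 10, 11, 12, 13, 14, 15, 16, 17, 18, 19, 20, 21, 22, 23, 24}"
  "writes evaluate_and_search = {2, 6, 7, 8, 9, 10, 11, 12, 13, 14, 15, 16, 17, 18, 19, 20, 21, 22, 23, 24}"
  "writes search_from_vertex = {2, 5, 6, 7, 8, 9, 10, 11, 12, 13, 14, 15, 16, 17, 18, 19, 20, 21, 22, 23, 24}"
  by (auto simp: lowest_bit_def carry_def next_subset_def enumerate_subsets_def search_def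
      evaluate_and_search_def search_from_vertex_def Let_def)

section \<open>Correctness and running time\<close>

lemma row_index_less: "u < i \<Longrightarrow> w < n \<Longrightarrow> u * n + w < i * (n :: nat)"
  using mult_le_mono1[of "Suc u" i n] by simp

lemma sum_lessThan_le: "(\<And>u. u < m \<Longrightarrow> f u \<le> c) \<Longrightarrow> (\<Sum>u<m. f u) \<le> m * (c :: nat)"
  using sum_bounded_above[of "{..<m}" f c] by simp

lemma bij_betw_append:
  assumes "bij_betw f {..<m} A" "x \<notin> A"
  shows "bij_betw (f(m := x)) {..<Suc m} (insert x A)"
proof -
  have "bij_betw (f(m := x)) {..<m} A" using assms(1) by (rule bij_betw_cong[THEN iffD1, rotated]) simp
  moreover have "bij_betw (f(m := x)) {m} {x}" by (simp add: bij_betw_def)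
  ultimately have "bij_betw (f(m := x)) ({..<m} \<union> {m}) (A \<union> {x})"
    using assms(2) by (intro bij_betw_combine) auto
  then show ?thesis by (simp add: lessThan_Suc)
qed

lemma subset_image_iff_bij_betw:
  assumes "bij_betw f {..<N} X"
  shows "(\<exists>T\<subseteq>{..<N}. card T \<le> d \<and> P (f ` T)) \<longleftrightarrow> (\<exists>D\<subseteq>X. card D \<le> d \<and> P D)"
proof -
  have inj: "inj_on f {..<N}" and im: "f ` {..<N} = X" using assms unfolding bij_betw_def by auto
  have card: "card (f ` T) = card T" if "T \<subseteq> {..<N}" for T
    using that by (intro card_image inj_on_subset[OF inj])
  show ?thesis
  proof
    assume "\<exists>T\<subseteq>{..<N}. card T \<le> d \<and> P (f ` T)"
    then show "\<exists>D\<subseteq>X. card D \<le> d \<and> P D" using card im by (metis image_mono)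
  next
    assume "\<exists>D\<subseteq>X. card D \<le> d \<and> P D"
    then show "\<exists>T\<subseteq>{..<N}. card T \<le> d \<and> P (f ` T)" using card im by (metis subset_imageE)
  qed
qed

section \<open>Subsets as binary codes\<close>

lemma set_encode_less: "S \<subseteq> {..<N} \<Longrightarrow> set_encode S < 2 ^ N"
proof -
  assume S: "S \<subseteq> {..<N}"
  then have "set_encode S \<le> (\<Sum>i<N. 2 ^ i)"
    unfolding set_encode_def using finite_subset[OF S] by (auto intro: sum_mono2)
  also have "\<dots> < 2 ^ N" by (simp add: sum_power2 lessThan_atLeast0)
  finally show ?thesis .
qed

lemma set_decode_subset: "m < 2 ^ N \<Longrightarrow> set_decode m \<subseteq> {..<N}"
proof
  fix x assume m: "m < 2 ^ N" and x: "x \<in> set_decode m"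
  show "x \<in> {..<N}"
  proof (rule ccontr)
    assume "x \<notin> {..<N}"
    then have "(2 :: nat) ^ N \<le> 2 ^ x" by (intro power_increasing) auto
    then have "m div 2 ^ x = 0" using m by (intro div_less) linarith
    then show False using x by (simp add: set_decode_def)
  qed
qed

text \<open>Adding less than \<open>2 ^ p\<close> to a code whose bits all lie at \<open>p\<close>
  or above causes no carry: the new set is \<open>S\<close> together with a nonempty set of
  positions below \<open>p\<close>. This justifies skipping these codes when \<open>S\<close>
  already has \<open>d\<close> elements.\<close>

lemma card_set_decode_between:
  assumes fin: "finite S" and low: "\<forall>x\<in>S. p \<le> x"
    and m: "set_encode S < m" "m < set_encode S + 2 ^ p"
  shows "card S < card (set_decode m)"
proof -
  define T where "T = set_decode (m - set_encode S)"
  have T: "T \<subseteq> {..<p}" unfolding T_def using m by (intro set_decode_subset) linarith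
  have finT: "finite T" using T finite_subset by blast
  have encT: "set_encode T = m - set_encode S" unfolding T_def by simp
  have disj: "S \<inter> T = {}" using low T by force
  have "set_encode (S \<union> T) = set_encode S + set_encode T"
    using fin finT disj by (simp add: set_encode_def sum.union_disjoint)
  then have "set_encode (S \<union> T) = m" using encT m by simp
  then have "set_decode m = S \<union> T" using fin finT set_encode_inverse[of "S \<union> T"] by simp
  moreover have "T \<noteq> {}" using encT m by auto
  ultimately show ?thesis using fin finT disj by (simp add: card_Un_disjoint card_gt_0_iff)
qed

text \<open>Evaluates the initial potential of the enumeration: the codes that may be visited
  correspond to the subsets of size at most \<open>d\<close>.\<close>

lemma card_small_codes:
  "card {m. m < 2 ^ N \<and> card (set_decode m) \<le> d} = (\<Sum>j\<le>d. N choose j)"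
proof -
  have "{m. m < 2 ^ N \<and> card (set_decode m) \<le> d} = set_encode ` {T. T \<subseteq> {..<N} \<and> card T \<le> d}" (is "?L = _ ` ?R")
  proof
    show "?L \<subseteq> set_encode ` ?R"
    proof
      fix m assume "m \<in> ?L"
      then have "m = set_encode (set_decode m)" "set_decode m \<in> ?R" using set_decode_subset by auto
      then show "m \<in> set_encode ` ?R" by (rule image_eqI)
    qed
    show "set_encode ` ?R \<subseteq> ?L"
      using set_encode_less finite_subset[OF _ finite_lessThan] by (auto simp: set_encode_inverse)
  qed
  moreover have "inj_on set_encode ?R"
    by (rule inj_on_subset[OF inj_on_set_encode]) (auto intro: finite_subset[OF _ finite_lessThan])
  moreover have "?R = (\<Union>j\<le>d. {T. T \<subseteq> {..<N} \<and> card T = j})" by auto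
  moreover have "card (\<Union>j\<le>d. {T. T \<subseteq> {..<N} \<and> card T = j}) = (\<Sum>j\<le>d. card {T. T \<subseteq> {..<N} \<and> card T = j})"
    by (intro card_UN_disjoint) (auto intro: finite_subset[of _ "Pow {..<N}"])
  ultimately show ?thesis by (simp add: card_image n_subsets)
qed

text \<open>\<open>B\<close> separates the verification of the program from the analysis of the
  exponent: it bounds, uniformly in \<open>d\<close>, the quadratic cost of a test times the number
  of subsets. \<open>W_ge\<close> covers intermediate sums up to 7 n^2.\<close>

locale clustering_instance =
  fixes E :: "nat \<Rightarrow> nat \<Rightarrow> bool" and n k W B :: nat
  assumes E_sym: "E u w = E w u"
    and k_le: "k \<le> n * n"
    and W_ge: "8 * ((n + 1) * (n + 1)) < W"
    and work_le_B: "N \<le> n \<Longrightarrow> admissible n k d N \<Longrightarrow> (N + 1)\<^sup>2 * (\<Sum>j\<le>d. N choose j) \<le> B"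
begin

lemma less_W: "n + 1 < W" "k + n + 1 < W" "n * n < W" "x \<le> 7 * (n * n) \<Longrightarrow> x < W"
  using W_ge k_le by (auto simp: algebra_simps)

definition tables :: "store \<Rightarrow> bool" where
  "tables s \<longleftrightarrow> s 0 0 = n \<and> s 0 1 = k \<and> (\<forall>u<n. \<forall>w<n. s 1 (u * n + w) = of_bool (E u w)) \<and>
     (\<forall>u\<le>n. s 3 u = u * n)"

lemma tables_cong: "tables s \<Longrightarrow> s' 0 = s 0 \<Longrightarrow> s' 1 = s 1 \<Longrightarrow> s' 3 = s 3 \<Longrightarrow> tables s'"
  unfolding tables_def by simp

lemma exec_mult_table:
  assumes "s 0 0 = n" "s 0 1 = k" "\<forall>u<n. \<forall>w<n. s 1 (u * n + w) = of_bool (E u w)"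
  shows "exec W mult_table s (\<lambda>t s'. t \<le> 30 * (n + 1) \<and> tables s')"
  unfolding mult_table_def exec_Seq exec_Write
proof (intro conjI, goal_cases)
  case 3
  show ?case
  proof (rule exec_for_loop[where m = n and K = 12 and I = "\<lambda>j s. \<forall>u\<le>j. s 3 u = u * n"], goal_cases)
    case (6 j s')
    have "j * n + n \<le> n * n" using 6(1) mult_le_mono1[of "Suc j" n n] by simp
    then show ?case using 6 less_W assms by (auto simp: le_Suc_eq)
  next
    case (7 t s')
    then show ?case using assms by (simp add: tables_def)
  qed (use less_W assms in auto)
qed (use less_W in auto)

section \<open>Start clusterings, their conflict data and the candidate list\<close>

definition start :: "(nat \<Rightarrow> bool) \<Rightarrow> store \<Rightarrow> bool" where
  "start \<sigma> s \<longleftrightarrow> tables s \<and> (\<forall>u<n. s 5 u = of_bool (\<sigma> u))"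

lemma exec_singleton_start:
  assumes "tables s" "s 4 0 = v"
  shows "exec W singleton_start s (\<lambda>t s'. t \<le> 40 * (n + 1) \<and> start (\<lambda>u. u = v) s')"
  unfolding singleton_start_def
proof (rule exec_for_loop[where m = n and K = 20 and I = "\<lambda>j s. \<forall>u<j. s 5 u = of_bool (u = v)"], goal_cases)
  case (6 j s')
  then show ?case using less_W assms by (auto simp: less_Suc_eq)
next
  case (7 t s')
  then show ?case using assms tables_cong[OF assms(1), of s'] by (simp add: start_def)
qed (use less_W assms in \<open>auto simp: tables_def\<close>)

lemma exec_neighbourhood_start:
  assumes "tables s" "s 4 0 = v" "v < n"
  shows "exec W neighbourhood_start s (\<lambda>t s'. t \<le> 40 * (n + 1) \<and> start (\<lambda>u. u = v \<or> E v u) s')"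
  unfolding neighbourhood_start_def
proof (rule exec_for_loop[where m = n and K = 22 and I = "\<lambda>j s. \<forall>u<j. s 5 u = of_bool (u = v \<or> E v u)"],
    goal_cases)
  case (6 j s')
  then show ?case using less_W assms by (auto simp: less_Suc_eq tables_def of_bool_def)
next
  case (7 t s')
  then show ?case using assms tables_cong[OF assms(1), of s'] by (simp add: start_def)
qed (use less_W assms in \<open>auto simp: tables_def\<close>)

lemma conflicts_le: "conflicts E {..<m} \<sigma> u \<le> m"
  unfolding conflicts_def using sum_bounded_above[of "{..<m}" "\<lambda>w. of_bool (conflict E \<sigma> u w)" "1 :: nat"]
  by simp

lemma conflicts_Suc:
  "conflicts E {..<Suc m} \<sigma> u = conflicts E {..<m} \<sigma> u + of_bool (conflict E \<sigma> u m)"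
  unfolding conflicts_def by simp

text \<open>Earlier rows occupy the cells below \<open>i * n\<close>; they are mentioned explicitly
  because array 6 is written and the frame rule says nothing about it.\<close>

lemma exec_conflict_row:
  assumes s: "start \<sigma> s" "s 10 0 = i" "i < n" "s 7 i = 0"
  shows "exec W conflict_row s (\<lambda>t s'. t \<le> 80 * (n + 1) \<and>
    (\<forall>w<n. s' 6 (i * n + w) = of_bool (conflict E \<sigma> i w)) \<and> (\<forall>a<i * n. s' 6 a = s 6 a) \<and>
    s' 7 = (s 7)(i := conflicts E {..<n} \<sigma> i))"
  unfolding conflict_row_def Let_def
proof (rule exec_for_loop[where m = n and K = 60 and I = "\<lambda>j s'.
    (\<forall>w<j. s' 6 (i * n + w) = of_bool (conflict E \<sigma> i w)) \<and> (\<forall>a<i * n. s' 6 a = s 6 a) \<and>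
    s' 7 = (s 7)(i := conflicts E {..<j} \<sigma> i)"], goal_cases)
  case (6 j s')
  have a: "i * n + j < W" using row_index_less[OF s(3) 6(1)] less_W by simp
  have c: "conflicts E {..<j} \<sigma> i + 1 < W" using conflicts_le[of j \<sigma> i] 6(1) less_W by simp
  show ?case using 6 less_W s a c
    by (auto simp: start_def tables_def less_Suc_eq conflicts_Suc conflict_def of_bool_def fun_eq_iff)
next
  case 5
  show ?case using s(4) by (auto simp: conflicts_def)
qed (use less_W s in \<open>auto simp: start_def tables_def\<close>)

definition evaluated :: "(nat \<Rightarrow> bool) \<Rightarrow> store \<Rightarrow> bool" where
  "evaluated \<sigma> s \<longleftrightarrow> start \<sigma> s \<and>
     (\<forall>u<n. \<forall>w<n. s 6 (u * n + w) = of_bool (conflict E \<sigma> u w)) \<and>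
     (\<forall>u<n. s 7 u = conflicts E {..<n} \<sigma> u) \<and>
     s 8 0 = total_conflicts E {..<n} \<sigma> \<and> s 9 0 = (\<Sum>u<n. of_bool (\<sigma> u))"

lemma exec_conflict_matrix:
  assumes s: "start \<sigma> s"
  shows "exec W conflict_matrix s (\<lambda>t s'. t \<le> 150 * (n + 1)\<^sup>2 \<and> evaluated \<sigma> s')"
proof -
  let ?I = "\<lambda>i s'. (\<forall>u<i. \<forall>w<n. s' 6 (u * n + w) = of_bool (conflict E \<sigma> u w)) \<and>
    (\<forall>u<i. s' 7 u = conflicts E {..<n} \<sigma> u) \<and>
    s' 8 0 = (\<Sum>u<i. conflicts E {..<n} \<sigma> u) \<and> s' 9 0 = (\<Sum>u<i. of_bool (\<sigma> u) :: nat)"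
  have "exec W (for_loop 10 (var 0)
       (Seq (Write 7 (var 10) (Const 0))
       (Seq (assign 9 (Add (var 9) (Read 5 (var 10))))
       (Seq conflict_row
         (assign 8 (Add (var 8) (Read 7 (var 10)))))))) s0
     (\<lambda>t s'. 6 + t \<le> 150 * (n + 1)\<^sup>2 \<and> evaluated \<sigma> s')"
    if s0: "start \<sigma> s0" "s0 8 0 = 0" "s0 9 0 = 0" for s0
  proof (rule exec_for_loop[where m = n and K = "80 * (n + 1) + 30" and I = ?I], goal_cases)
    case (6 i s')
    let ?s = "s'(7 := (s' 7)(i := 0), 9 := (s' 9)(0 := s' 9 0 + s' 5 i))"
    have st: "start \<sigma> ?s" using s0(1) 6 unfolding start_def tables_def by simp
    have "(\<Sum>u<i. of_bool (\<sigma> u)) \<le> i * (1 :: nat)" by (rule sum_lessThan_le) simp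
    then have b9: "(\<Sum>u<i. of_bool (\<sigma> u)) + 1 < W" using 6(1) less_W by simp
    have "(\<Sum>u<Suc i. conflicts E {..<n} \<sigma> u) \<le> Suc i * n"
      by (rule sum_lessThan_le) (rule conflicts_le)
    also have "\<dots> \<le> n * n" using 6(1) by (intro mult_le_mono1) simp
    finally have b8: "(\<Sum>u<i. conflicts E {..<n} \<sigma> u) + conflicts E {..<n} \<sigma> i < W" using less_W by simp
    have "exec W conflict_row ?s (\<lambda>t s''. exec W (assign 8 (Add (var 8) (Read 7 (var 10)))) s''
        (\<lambda>t'. \<lambda>s3. 12 + (t + t') \<le> 80 * (n + 1) + 30 \<and> ?I (Suc i) s3))"
    proof (rule exec_conseq[OF exec_conflict_row[OF st, where i = i]], goal_cases)
      case (4 t s'')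
      have "s'' 6 (u * n + w) = s' 6 (u * n + w)" if "u < i" "w < n" for u w
        using 4 row_index_less[OF that] by simp
      then show ?case using 4 6(1-3) b8 less_W st by (auto simp: less_Suc_eq start_def)
    qed (use 6 in auto)
    then show ?case using 6 b9 less_W st by (simp add: start_def tables_def)
  next
    case (7 t s')
    then have "start \<sigma> s'" using s0(1) unfolding start_def tables_def by simp
    then show ?case using 7 by (auto simp: evaluated_def total_conflicts_def power2_eq_square algebra_simps)
  qed (use less_W s0 in \<open>auto simp: start_def tables_def\<close>)
  from this[of "s(8 := (s 8)(0 := 0), 9 := (s 9)(0 := 0))"] show ?thesis
    using s less_W unfolding conflict_matrix_def
    by (auto simp: start_def tables_def elim: exec_conseq)
qed

lemma exec_collect_candidates:
  assumes s: "evaluated \<sigma> s" "s 12 0 = d"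
  defines "X \<equiv> candidates E {..<n} \<sigma> d"
  shows "exec W collect_candidates s (\<lambda>t s'. t \<le> 100 * (n + 1) \<and> s' 15 0 = card X \<and>
    bij_betw (s' 14) {..<card X} X \<and> s' 16 0 = (card X - d) * (n - 6 * d))"
proof -
  define A where "A i = {u. u < i \<and> n \<le> 2 * conflicts E {..<n} \<sigma> u + 2 * d}" for i
  have A0: "A 0 = {}" unfolding A_def by simp
  have AS: "A (Suc i) = (if n \<le> 2 * conflicts E {..<n} \<sigma> i + 2 * d then insert i (A i) else A i)" for i
    unfolding A_def by (auto simp: less_Suc_eq)
  have fin: "finite (A i)" for i unfolding A_def by simp
  have cardA: "card (A i) \<le> i" for i
    using card_mono[of "{..<i}" "A i"] unfolding A_def by auto
  have notin: "i \<notin> A i" for i unfolding A_def by simp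
  let ?I = "\<lambda>i s'. s' 15 0 = card (A i) \<and> bij_betw (s' 14) {..<card (A i)} (A i) \<and>
    s' 16 0 = (card (A i) - d) * (n - 6 * d)"
  have "exec W (for_loop 10 (var 0)
      (Cond (leq_expr (var 0) (double (Add (Read 7 (var 10)) (var 12))))
        (Seq (Cond (leq_expr (var 12) (var 15))
               (assign 16 (Add (var 16) (Sub (var 0) (double (Add (double (var 12)) (var 12))))))
               Skip)
        (Seq (Write 14 (var 15) (var 10)) (incr 15)))
        Skip)) s0
     (\<lambda>t s'. 6 + t \<le> 100 * (n + 1) \<and> ?I n s')"
    if s0: "evaluated \<sigma> s0" "s0 12 0 = d" "s0 15 0 = 0" "s0 16 0 = 0" for s0
  proof (rule exec_for_loop[where m = n and K = 70 and I = ?I], goal_cases)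
    case (6 i s')
    have ev: "s' 0 0 = n" "s' 7 i = conflicts E {..<n} \<sigma> i" "s' 12 0 = d"
      using s0 6 by (auto simp: evaluated_def start_def tables_def)
    have "(Suc (card (A i)) - d) * (n - 6 * d) \<le> n * n"
      using cardA[of i] 6(1) by (intro mult_le_mono) auto
    then have acc: "(Suc (card (A i)) - d) * (n - 6 * d) < W" using less_W by simp
    have "card (A i) < W" "Suc (card (A i)) < W" "i < W" using cardA[of i] 6(1) less_W by auto
    moreover have "n - (d + d + d + (d + d + d)) = n - 6 * d" by simp
    moreover have "(Suc (card (A i)) - d) * (n - 6 * d) =
        (if d \<le> card (A i) then (card (A i) - d) * (n - 6 * d) + (n - 6 * d) else 0)"
      by (simp add: Suc_diff_le)
    moreover have "n < Suc (conflicts E {..<n} \<sigma> i + d + (conflicts E {..<n} \<sigma> i + d)) \<longleftrightarrow>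
        n \<le> 2 * conflicts E {..<n} \<sigma> i + 2 * d" by linarith
    ultimately show ?case
      using 6 ev acc fin[of i] notin[of i] bij_betw_append[of "s' 14" "card (A i)" "A i" i] AS[of i]
      by (cases "n \<le> 2 * conflicts E {..<n} \<sigma> i + 2 * d"; cases "d \<le> card (A i)")
        (simp_all add: not_less[symmetric])
  qed (use less_W s0 in \<open>auto simp: A0 bij_betw_def evaluated_def start_def tables_def\<close>)
  from this[of "s(15 := (s 15)(0 := 0), 16 := (s 16)(0 := 0))"]
  have "exec W collect_candidates s (\<lambda>t s'. t \<le> 100 * (n + 1) \<and> ?I n s')"
    using s less_W unfolding collect_candidates_def
    by (auto simp: evaluated_def start_def tables_def elim: exec_conseq)
  moreover have "A n = X" unfolding A_def X_def candidates_def by auto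
  ultimately show ?thesis by simp
qed

section \<open>Testing one flip\<close>

definition listed :: "(nat \<Rightarrow> bool) \<Rightarrow> nat \<Rightarrow> nat \<Rightarrow> (nat \<Rightarrow> nat) \<Rightarrow> store \<Rightarrow> bool" where
  "listed \<sigma> d N f s \<longleftrightarrow> evaluated \<sigma> s \<and> s 12 0 = d \<and> s 15 0 = N \<and> s 14 = f"

lemma listed_frame:
  assumes "listed \<sigma> d N f s" "\<forall>a. a \<notin> A \<longrightarrow> s' a = s a" "A \<inter> {0, 1, 3, 5, 6, 7, 8, 9, 12, 14, 15} = {}"
  shows "listed \<sigma> d N f s'"
proof -
  have "s' a = s a" if "a \<in> {0, 1, 3, 5, 6, 7, 8, 9, 12, 14, 15}" for a using assms that by blast
  then show ?thesis using assms(1) unfolding listed_def evaluated_def start_def tables_def by simp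
qed

definition bits :: "nat \<Rightarrow> store \<Rightarrow> nat set" where
  "bits N s = {x. x < N \<and> s 17 x \<noteq> 0}"

lemma listedD:
  assumes "listed \<sigma> d N f s"
  shows "s 0 0 = n" "s 0 (Suc 0) = k" "s 12 0 = d" "s 15 0 = N" "s 14 = f"
    "\<And>u. u < n \<Longrightarrow> s 5 u = of_bool (\<sigma> u)" "\<And>u. u \<le> n \<Longrightarrow> s 3 u = u * n"
    "\<And>u w. u < n \<Longrightarrow> w < n \<Longrightarrow> s 6 (u * n + w) = of_bool (conflict E \<sigma> u w)"
    "\<And>u. u < n \<Longrightarrow> s 7 u = conflicts E {..<n} \<sigma> u"
    "s 8 0 = total_conflicts E {..<n} \<sigma>" "s 9 0 = (\<Sum>u<n. of_bool (\<sigma> u))"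
  using assms unfolding listed_def evaluated_def start_def tables_def by auto

lemma exec_test_row:
  assumes s: "listed \<sigma> d N f s" and N: "N \<le> n" and f: "f ` {..<N} \<subseteq> {..<n}"
    and i: "s 10 0 = i" "i < N" and L: "s 20 0 = L" "L + N * 4 < W"
  shows "exec W test_row s (\<lambda>t s'. t \<le> 80 * (N + 1) \<and>
    s' 20 0 = L + (\<Sum>y<N. if y \<in> bits N s then 4 * of_bool (conflict E \<sigma> (f i) (f y)) else 0))"
  unfolding test_row_def
proof (rule exec_for_loop[where m = N and K = 68 and I = "\<lambda>j s'. s' 20 0 =
    L + (\<Sum>y<j. if y \<in> bits N s then 4 * of_bool (conflict E \<sigma> (f i) (f y)) else 0)"], goal_cases)
  case (6 j s')
  have l: "listed \<sigma> d N f s'" by (rule listed_frame[OF s 6(4)]) auto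
  have "L + x < W" if "x \<le> Suc j * 4" for x using that L(2) 6(1) by simp
  then have b: "L + (\<Sum>y<Suc j. if y \<in> bits N s then 4 * of_bool (conflict E \<sigma> (f i) (f y)) else 0) < W"
    using sum_lessThan_le[of "Suc j" "\<lambda>y. if y \<in> bits N s then 4 * of_bool (conflict E \<sigma> (f i) (f y)) else 0" 4]
    by fastforce
  have "f i < n" "f j < n" using f i 6(1) by auto
  moreover have "s' 17 j = 0 \<longleftrightarrow> j \<notin> bits N s" using 6(1,4) by (simp add: bits_def)
  moreover have "s' 10 0 = i" using 6(4) i(1) by simp
  ultimately show ?case using 6(1-3) listedD[OF l] L b less_W
    by (cases "j \<in> bits N s") simp_all
qed (use less_W s N L in \<open>auto dest!: listedD(4)\<close>)

lemma exec_test_flip: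
  assumes s: "listed \<sigma> d N f s" and N: "N \<le> n"
    and f: "inj_on f {..<N}" "f ` {..<N} \<subseteq> {..<n}"
    and S: "bits N s = S" "s 18 0 = card S"
  shows "exec W test_flip s (\<lambda>t s'. t \<le> 220 * (N + 1)\<^sup>2 \<and>
    s' 2 0 = (if good_clustering E {..<n} k (flip (f ` S) \<sigma>) then 1 else s 2 0))"
proof -
  let ?V = "{..<n}"
  define l where "l x = 2 * (n - card S) +
    (\<Sum>y<N. if y \<in> S then 4 * of_bool (conflict E \<sigma> (f x) (f y)) else 0)" for x
  define L where "L i = total_conflicts E ?V \<sigma> + (\<Sum>x<i. if x \<in> S then l x else 0)" for i
  define R where "R i = k + (\<Sum>x<i. if x \<in> S then 4 * conflicts E ?V \<sigma> (f x) else 0)" for i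
  define P where "P i = (\<Sum>u<n. of_bool (\<sigma> u)) + (\<Sum>x<i. if x \<in> S then of_bool (\<not> \<sigma> (f x)) else 0 :: nat)" for i
  define M where "M i = (\<Sum>x<i. if x \<in> S then of_bool (\<sigma> (f x)) else 0 :: nat)" for i
  have l_le: "l x \<le> 6 * n" for x
  proof -
    have "(\<Sum>y<N. if y \<in> S then 4 * of_bool (conflict E \<sigma> (f x) (f y)) else 0) \<le> N * (4 :: nat)"
      by (rule sum_lessThan_le) auto
    then show ?thesis unfolding l_def using N by simp
  qed
  have tot: "total_conflicts E ?V \<sigma> \<le> n * n"
    unfolding total_conflicts_def by (rule sum_lessThan_le) (rule conflicts_le)
  \<comment> \<open>At most \<open>n * n\<close> for the start clustering plus
    \<open>Suc i \<le> n\<close> contributions of at most \<open>6 * n\<close> each. This is where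
    the constant 7 in \<open>less_W\<close> comes from.\<close>
  have L_le: "total_conflicts E ?V \<sigma> + (\<Sum>x<i. if x \<in> S then l x else 0) + 6 * n < W" if "i < N" for i
  proof -
    have "(\<Sum>x<i. if x \<in> S then l x else 0) \<le> i * (6 * n)" using l_le by (intro sum_lessThan_le) auto
    moreover have "Suc i * (6 * n) \<le> n * (6 * n)" using that N by (intro mult_le_mono1) simp
    ultimately show ?thesis using tot by (intro less_W) simp
  qed
  have R_le: "k + (\<Sum>x<i. if x \<in> S then 4 * conflicts E ?V \<sigma> (f x) else 0) + 4 * n < W" if "i < N" for i
  proof -
    have "(\<Sum>x<i. if x \<in> S then 4 * conflicts E ?V \<sigma> (f x) else 0) \<le> i * (4 * n)"
      using conflicts_le[of n \<sigma>] by (intro sum_lessThan_le) auto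
    moreover have "Suc i * (4 * n) \<le> n * (4 * n)" using that N by (intro mult_le_mono1) simp
    ultimately show ?thesis using k_le by (intro less_W) simp
  qed
  have nn: "2 * n + 1 < W" using W_ge by simp
  have sig: "(\<Sum>u<n. of_bool (\<sigma> u)) \<le> n * (1 :: nat)" by (rule sum_lessThan_le) simp
  have P_le: "P i + 1 < W" if "i < N" for i
  proof -
    have "(\<Sum>x<i. if x \<in> S then of_bool (\<not> \<sigma> (f x)) else 0 :: nat) \<le> i * 1" by (rule sum_lessThan_le) auto
    then show ?thesis unfolding P_def using sig that N nn by linarith
  qed
  have M_le: "M i + 1 < W" if "i < N" for i
  proof -
    have "(\<Sum>x<i. if x \<in> S then of_bool (\<sigma> (f x)) else 0 :: nat) \<le> i * 1" by (rule sum_lessThan_le) auto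
    then show ?thesis unfolding M_def using that N nn by linarith
  qed
  let ?D = "f ` S"
  have SN: "S \<subseteq> {..<N}" using S(1) unfolding bits_def by auto
  have inj: "inj_on f S" using f(1) SN by (rule inj_on_subset)
  \<comment> \<open>The loops run over list positions and mask by \<open>S\<close>; injectivity of
    \<open>f\<close> turns them into sums over the flipped vertices.\<close>
  have restrict: "(\<Sum>x<N. if x \<in> S then g (f x) else 0) = (\<Sum>u\<in>?D. g u)" for g :: "nat \<Rightarrow> nat"
    using SN inj by (simp add: sum.If_cases sum.reindex Int_absorb1)
  have DV: "?D \<subseteq> ?V" using f(2) SN by auto
  have lx: "l x = 2 * (card ?V - card ?D) + 4 * conflicts E ?D \<sigma> (f x)" for x
    unfolding l_def conflicts_def restrict[of "\<lambda>u. 4 * of_bool (conflict E \<sigma> (f x) u)"]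
    using inj by (simp add: card_image sum_distrib_left)
  have LN: "L N = total_conflicts E ?V \<sigma> + (\<Sum>u\<in>?D. 2 * (card ?V - card ?D) + 4 * conflicts E ?D \<sigma> u)"
    unfolding L_def lx restrict[of "\<lambda>u. 2 * (card ?V - card ?D) + 4 * conflicts E ?D \<sigma> u"] ..
  have RN: "R N = k + (\<Sum>u\<in>?D. 4 * conflicts E ?V \<sigma> u)"
    unfolding R_def restrict[of "\<lambda>u. 4 * conflicts E ?V \<sigma> u"] ..
  have PN: "P N = (\<Sum>u<n. of_bool (\<sigma> u)) + (\<Sum>u\<in>?D. of_bool (\<not> \<sigma> u))"
    unfolding P_def restrict[of "\<lambda>u. of_bool (\<not> \<sigma> u)"] ..
  have MN: "M N = (\<Sum>u\<in>?D. of_bool (\<sigma> u))"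
    unfolding M_def restrict[of "\<lambda>u. of_bool (\<sigma> u)"] ..
  have good: "good_clustering E ?V k (flip ?D \<sigma>) \<longleftrightarrow> L N \<le> R N \<and> M N < P N \<and> P N < n + M N"
    unfolding LN RN PN MN
    using good_clustering_flip_iff[where V = ?V and D = ?D and E = E and k = k and \<sigma> = \<sigma>] DV E_sym by simp
  let ?I = "\<lambda>i s'. s' 20 0 = L i \<and> s' 21 0 = R i \<and> s' 22 0 = P i \<and> s' 23 0 = M i"
  let ?s = "s(20 := (s 20)(0 := s 8 0), 21 := (s 21)(0 := s 0 1), 22 := (s 22)(0 := s 9 0), 23 := (s 23)(0 := 0))"
  have s0: "listed \<sigma> d N f ?s" by (rule listed_frame[OF s, where A = "{20, 21, 22, 23}"]) auto
  let ?Q = "\<lambda>t s'. t \<le> (N + 1) * (80 * (N + 1) + 72) \<and> ?I N s'"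
  have loop: "exec W (for_loop 10 (var 15)
      (Cond (Read 17 (var 10))
        (Seq (assign 20 (Add (var 20) (double (Sub (var 0) (var 18)))))
        (Seq (assign 21 (Add (var 21) (double (double (Read 7 (Read 14 (var 10)))))))
        (Seq (Cond (Read 5 (Read 14 (var 10))) (incr 23) (incr 22))
          test_row)))
        Skip)) ?s ?Q"
  proof (rule exec_for_loop[where m = N and K = "80 * (N + 1) + 60" and I = ?I], goal_cases)
    case (6 i s')
    have l: "listed \<sigma> d N f s'" by (rule listed_frame[OF s0 6(4)]) auto
    have fi: "f i < n" using f(2) 6(1) by auto
    have b17: "s' 17 i = 0 \<longleftrightarrow> i \<notin> S" using 6(1,4) S(1) by (auto simp: bits_def)
    show ?case
    proof (cases "i \<in> S")
      case False
      then show ?thesis using 6 b17 by (simp add: L_def R_def P_def M_def)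
    next
      case True
      let ?r = "\<lambda>s'. s'(20 := (s' 20)(0 := L i + 2 * (n - card S)),
        21 := (s' 21)(0 := R i + 4 * conflicts E ?V \<sigma> (f i)))"
      define s1 where "s1 = (if \<sigma> (f i) then (?r s')(23 := (s' 23)(0 := M (Suc i)))
        else (?r s')(22 := (s' 22)(0 := P (Suc i))))"
      have l1: "listed \<sigma> d N f s1"
        by (rule listed_frame[OF l, where A = "{20, 21, 22, 23}"]) (auto simp: s1_def)
      have bits1: "bits N s1 = S" using 6(4) S(1) by (auto simp: s1_def bits_def)
      have bl: "L i + 2 * (n - card S) + N * 4 < W" using L_le[OF 6(1)] N unfolding L_def by simp
      have "exec W test_row s1 (\<lambda>t s''. 55 + t \<le> 80 * (N + 1) + 60 \<and> ?I (Suc i) s'')"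
      proof (rule exec_conseq[OF exec_test_row[OF l1 N f(2), where i = i and L = "L i + 2 * (n - card S)"]],
          goal_cases)
        case (5 t s'')
        then show ?case using True 6(2) unfolding bits1
          by (auto simp: s1_def L_def R_def P_def M_def l_def)
      qed (use 6(1,3) bl in \<open>auto simp: s1_def\<close>)
      moreover have "s' 18 0 = card S" using 6(4) S(2) by simp
      moreover have "R i + 4 * conflicts E ?V \<sigma> (f i) < W"
        using R_le[OF 6(1)] conflicts_le[of n \<sigma> "f i"] unfolding R_def by simp
      moreover have "L i + 2 * (n - card S) < W" using bl by simp
      moreover have "P (Suc i) = P i + of_bool (\<not> \<sigma> (f i))" "M (Suc i) = M i + of_bool (\<sigma> (f i))"
        unfolding P_def M_def using True by simp_all
      ultimately show ?thesis
        using True 6(1-3) b17 listedD[OF l] fi P_le[OF 6(1)] M_le[OF 6(1)] less_W(1) unfolding s1_def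
        by (cases "\<sigma> (f i)") (simp_all add: mult_2[symmetric])
    qed
  qed (use less_W s s0 N in \<open>auto simp: L_def R_def P_def M_def listedD\<close>)
  have w: "s 8 0 < W" "s 0 1 < W" "s 9 0 < W" "0 < W" "1 < W"
    using listedD[OF s] tot sig less_W by auto
  have final: "exec W (Cond (leq_expr (var 20) (var 21))
      (Cond (less_expr (var 23) (var 22))
        (Cond (less_expr (var 22) (Add (var 0) (var 23))) (assign 2 (Const 1)) Skip) Skip) Skip) s'
      (\<lambda>t' s''. 16 + (t + t') \<le> t + 60 \<and>
        s'' 2 0 = (if good_clustering E ?V k (flip ?D \<sigma>) then 1 else s 2 0))"
    if "?I N s'" "s' 0 0 = n" "s' 2 0 = s 2 0" for t s'
    using that w by (auto simp: good)
  have "exec W test_flip s (\<lambda>t s'. t \<le> (N + 1) * (80 * (N + 1) + 72) + 60 \<and>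
    s' 2 0 = (if good_clustering E ?V k (flip ?D \<sigma>) then 1 else s 2 0))"
    unfolding test_flip_def using w
    by (simp del: exec_Cond One_nat_def split del: if_split)
      (rule exec_conseq[OF loop], rule exec_conseq[OF final], use listedD(1)[OF s] in auto)
  then show ?thesis
    by (rule exec_conseq) (auto simp: power2_eq_square algebra_simps)
qed

section \<open>Enumerating the small subsets with a binary counter\<close>

lemma bits_fun_upd [simp]: "a \<noteq> 17 \<Longrightarrow> bits N (s(a := x)) = bits N s"
  unfolding bits_def by simp

lemma exec_lowest_bit:
  assumes "s 15 0 = N" "N < W"
  shows "exec W lowest_bit s (\<lambda>t s'. t \<le> 50 * (N + 1) \<and> s' 24 0 \<le> N \<and>
    (\<forall>x<s' 24 0. s 17 x = 0) \<and> (s' 24 0 < N \<longrightarrow> s 17 (s' 24 0) \<noteq> 0))"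
proof -
  \<comment> \<open>The scan goes from position \<open>N - 1\<close> downwards, so the last hit is
    the lowest bit; the initial value \<open>N\<close> remains if the set is empty.\<close>
  let ?I = "\<lambda>i s'. N - i \<le> s' 24 0 \<and> s' 24 0 \<le> N \<and>
    (\<forall>x. N - i \<le> x \<longrightarrow> x < s' 24 0 \<longrightarrow> s 17 x = 0) \<and> (s' 24 0 < N \<longrightarrow> s 17 (s' 24 0) \<noteq> 0)"
  let ?s = "s(24 := (s 24)(0 := N))"
  have "exec W (for_loop 10 (var 15) (Cond (Read 17 (Sub (var 15) (Add (var 10) (Const 1))))
      (assign 24 (Sub (var 15) (Add (var 10) (Const 1)))) Skip)) ?s
    (\<lambda>t s'. 4 + t \<le> 50 * (N + 1) \<and> ?I N s')"
  proof (rule exec_for_loop[where m = N and K = 30 and I = ?I], goal_cases)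
    case (6 i s')
    have eq: "s' 15 0 = N" "s' 17 = s 17" using 6(4) assms(1) by auto
    have x: "x = N - Suc i \<or> N - i \<le> x" if "N - Suc i \<le> x" for x using that by linarith
    show ?case using 6(1-3) eq assms(2) x by (cases "s 17 (N - Suc i) = 0") auto
  qed (use assms in auto)
  then show ?thesis using assms unfolding lowest_bit_def Let_def
    by (auto elim: exec_conseq)
qed

text \<open>Clearing bit q and moving on to q + 1 preserves the code plus \<open>2 ^ q\<close>, so
  the loop performs the carry of adding \<open>2 ^ p\<close>. The number of cleared bits is the
  distance travelled.\<close>

lemma exec_carry:
  assumes s: "s 24 0 = p" "p \<le> N" "s 17 N = 0" "s 18 0 = card (bits N s)" and W: "N + 1 < W" "card (bits N s) < W"
  shows "exec W carry s (\<lambda>t s'. t \<le> 30 * (N + 1) \<and> s' 24 0 \<le> N \<and> s' 17 (s' 24 0) = 0 \<and> s' 17 N = 0 \<and>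
    set_encode (bits N s') + 2 ^ s' 24 0 = set_encode (bits N s) + 2 ^ p \<and>
    s' 18 0 = card (bits N s') \<and> card (bits N s') + (s' 24 0 - p) = card (bits N s) \<and>
    (s' 24 0 = p \<longrightarrow> s' 17 = s 17) \<and> p \<le> s' 24 0)"
  unfolding carry_def
proof (rule exec_potential_loop[where \<Phi> = "\<lambda>s. (N - s 24 0) * 20" and
    I = "\<lambda>s'. s' 24 0 \<le> N \<and> s' 17 N = 0 \<and>
    set_encode (bits N s') + 2 ^ s' 24 0 = set_encode (bits N s) + 2 ^ p \<and>
    s' 18 0 = card (bits N s') \<and> card (bits N s') + (s' 24 0 - p) = card (bits N s) \<and>
    (s' 24 0 = p \<longrightarrow> s' 17 = s 17) \<and> p \<le> s' 24 0"], goal_cases)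
  case (2 s')
  define q where "q = s' 24 0"
  have q0: "s' 17 q \<noteq> 0" "q \<le> N" "s' 17 N = 0" using 2 unfolding q_def by simp_all
  then have "q \<noteq> N" by metis
  then have q: "q < N" "s' 17 q \<noteq> 0" using q0 by simp_all
  define T where "T = bits N s' - {q}"
  have fin: "finite (bits N s')" unfolding bits_def by simp
  have qin: "q \<in> bits N s'" using q unfolding bits_def by simp
  have b: "bits N (s'(17 := (s' 17)(q := 0))) = T" unfolding T_def bits_def by auto
  have enc: "set_encode (bits N s') = 2 ^ q + set_encode T"
    using set_encode_insert[of T q] fin qin unfolding T_def by (simp add: insert_absorb)
  have c: "card (bits N s') = Suc (card T)"
    using card_Suc_Diff1[OF fin qin] unfolding T_def by simp
  have "q < W" "Suc q < W" "card T < W" using q W 2 c by auto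
  moreover have "s' 18 0 - 1 = card T" using 2 c by simp
  moreover have "Suc q - p = Suc (q - p)" "q \<noteq> p \<longrightarrow> p < q" "p \<le> q" using 2 unfolding q_def by auto
  moreover have "(N - Suc q) * 20 + 20 = (N - q) * 20" using q by simp
  ultimately show ?case using 2 q enc c b unfolding q_def[symmetric] by (simp add: q_def[symmetric])
next
  case (3 t s')
  then show ?case using s by auto
qed (use s in auto)

text \<open>The witness \<open>q\<close> is the old code plus \<open>2 ^ p\<close>, with p = 0 if
  the set has fewer than \<open>d\<close> elements and otherwise the position found by
  \<open>lowest_bit\<close>. If the carry arrives at position \<open>N\<close>, this sum is at least
  \<open>2 ^ N\<close> and the enumeration ends.\<close>

lemma exec_next_subset:
  assumes s: "s 12 0 = d" "s 15 0 = N" "s 17 N = 0" "s 18 0 = card (bits N s)" "card (bits N s) \<le> d" "s 19 0 \<noteq> 0"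
    and W: "N + 1 < W"
  shows "exec W next_subset s (\<lambda>t s'. t \<le> 130 * (N + 1) \<and>
    s' 17 N = 0 \<and> s' 18 0 = card (bits N s') \<and> card (bits N s') \<le> d \<and>
    (\<exists>q > set_encode (bits N s).
      (\<forall>m. set_encode (bits N s) < m \<longrightarrow> m < q \<longrightarrow> d < card (set_decode m)) \<and>
      (if s' 19 0 = 0 then 2 ^ N \<le> q else set_encode (bits N s') = q)))"
  (is "exec W _ _ ?Q")
proof -
  let ?S = "bits N s"
  have cN: "card (bits N s') \<le> N" for s'
    using card_mono[of "{..<N}" "bits N s'"] unfolding bits_def by auto
  have fin: "finite ?S" unfolding bits_def by simp
  define tail where "tail = Seq carry (Cond (less_expr (var 24) (var 15))
        (Seq (Write 17 (var 24) (Const 1)) (incr 18)) (assign 19 (Const 0)))"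
  have tail: "exec W tail s' (\<lambda>t' s''. t + t' \<le> t + 70 * (N + 1) \<and> ?Q 0 s'')"
    if frame: "s' 12 = s 12" "s' 15 = s 15" "s' 17 = s 17" "s' 18 = s 18" "s' 19 = s 19"
      and p: "s' 24 0 = p" "p \<le> N" "card ?S < d \<and> p = 0 \<or> card ?S = d \<and> (\<forall>x<p. s 17 x = 0) \<and> (p < N \<longrightarrow> s 17 p \<noteq> 0)"
    for s' p t
  proof -
    have S': "bits N s' = ?S" unfolding bits_def frame ..
    have skip: "d < card (set_decode m)" if m: "set_encode ?S < m" "m < set_encode ?S + 2 ^ p" for m
    proof (cases "card ?S < d \<and> p = 0")
      case True
      then show ?thesis using m by simp
    next
      case False
      then have "\<forall>x\<in>?S. p \<le> x" "card ?S = d" using p(3) unfolding bits_def by (auto simp: not_less[symmetric] simp del: not_less)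
      then show ?thesis using card_set_decode_between[OF fin _ m] by simp
    qed
    show ?thesis unfolding tail_def exec_Seq
    proof (rule exec_conseq[OF exec_carry[of s' p N]], goal_cases)
      case (7 u s'')
      define q where "q = s'' 24 0"
      have f: "s'' 15 0 = N" "s'' 19 = s 19" using 7 frame s by auto
      have q: "q \<le> N" "s'' 17 q = 0" "s'' 17 N = 0" "set_encode (bits N s'') + 2 ^ q = set_encode ?S + 2 ^ p"
        "s'' 18 0 = card (bits N s'')" "card (bits N s'') + (q - p) = card ?S" "q = p \<longrightarrow> s'' 17 = s 17" "p \<le> q"
        "u \<le> 30 * (N + 1)"
        using 7 unfolding q_def S' frame by auto
      show ?case
      proof (cases "q < N")
        case True
        let ?s = "s''(17 := (s'' 17)(q := 1))"
        have b: "bits N ?s = insert q (bits N s'')" "q \<notin> bits N s''" "finite (bits N s'')"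
          using True q unfolding bits_def by auto
        have c: "card (bits N ?s) = Suc (card (bits N s''))" using b by simp
        have e: "set_encode (bits N ?s) = set_encode ?S + 2 ^ p"
          using b q set_encode_insert[of "bits N s''" q] by simp
        \<comment> \<open>Without a carry, bit \<open>p\<close> was clear, which is only possible
          when fewer than \<open>d\<close> bits were set. With a carry at least one bit was cleared
          before one is set.\<close>
        have "card (bits N ?s) \<le> d"
        proof (cases "q = p")
          case True
          then have "s 17 p = 0" using q by simp
          then have "card ?S < d" using p(3) True \<open>q < N\<close> by auto
          then show ?thesis using q(6) c by simp
        next
          case False
          then show ?thesis using q(6,8) c s(5) by simp
        qed
        then show ?thesis using True q f c e skip W cN[of ?s] s(6) unfolding q_def[symmetric]
          by (auto simp: f q_def[symmetric] intro!: exI[of _ "set_encode ?S + 2 ^ p"])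
      next
        case False
        then have "q = N" using q by simp
        then have "2 ^ N \<le> set_encode ?S + 2 ^ p" using q(4) by (metis le_add2)
        moreover have "card (bits N s'') \<le> d" using q(6) s(5) by simp
        ultimately show ?thesis using q f \<open>q = N\<close> skip W unfolding q_def[symmetric]
          by (auto simp: f q_def[symmetric] intro!: exI[of _ "set_encode ?S + 2 ^ p"])
      qed
    qed (use S' s frame p W cN[of s] in auto)
  qed
  show ?thesis unfolding next_subset_def tail_def[symmetric] exec_Seq
  proof (rule exec_conseq[OF exec_lowest_bit[of s N]], goal_cases)
    case (3 t s')
    show ?case
    proof (cases "card ?S < d")
      case True
      have "exec W tail (s'(24 := (s' 24)(0 := 0))) (\<lambda>t' s''. 20 + t + t' \<le> 20 + t + 70 * (N + 1) \<and> ?Q 0 s'')"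
        by (rule tail[where p = 0]) (use 3 True in auto)
      then show ?thesis using True 3 s W by (auto elim!: exec_conseq)
    next
      case False
      have "exec W tail s' (\<lambda>t' s''. 20 + t + t' \<le> 20 + t + 70 * (N + 1) \<and> ?Q 0 s'')"
        by (rule tail[where p = "s' 24 0"]) (use 3 False s in auto)
      then show ?thesis using False 3 s W by (auto elim!: exec_conseq)
    qed
  qed (use s W in auto)
qed

text \<open>The potential counts the codes from the current one on that have at most
  \<open>d\<close> bits, each worth \<open>400 * (N + 1)\<^sup>2\<close> units. An iteration uses up
  at least the current code, and the codes jumped over are too large to matter for the
  answer.\<close>

lemma exec_enumerate_subsets:
  assumes s: "listed \<sigma> d N f s" and N: "N \<le> n"
    and f: "inj_on f {..<N}" "f ` {..<N} \<subseteq> {..<n}" and a: "s 2 0 = of_bool a"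
  shows "exec W enumerate_subsets s (\<lambda>t s'.
    t \<le> 400 * ((N + 1)\<^sup>2 * (\<Sum>j\<le>d. N choose j)) + 50 * (N + 1) \<and>
    s' 2 0 = of_bool (a \<or> (\<exists>T\<subseteq>{..<N}. card T \<le> d \<and> good_clustering E {..<n} k (flip (f ` T) \<sigma>))))"
    (is "exec W _ _ ?Q")
proof -
  let ?good = "\<lambda>m. card (set_decode m) \<le> d \<and> good_clustering E {..<n} k (flip (f ` set_decode m) \<sigma>)"
  let ?code = "\<lambda>s. set_encode (bits N s)"
  define rest where "rest c = {m. c \<le> m \<and> m < 2 ^ N \<and> card (set_decode m) \<le> d}" for c
  let ?\<Phi> = "\<lambda>s. if s 19 0 = 0 then 0 else 400 * (N + 1)\<^sup>2 * card (rest (?code s))"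
  let ?I = "\<lambda>s. s 17 N = 0 \<and> s 18 0 = card (bits N s) \<and> card (bits N s) \<le> d \<and>
    s 2 0 = of_bool (a \<or> (\<exists>m < (if s 19 0 = 0 then 2 ^ N else ?code s). ?good m))"
  have NW: "N + 1 < W" using N less_W by simp
  have bN: "bits N s' \<subseteq> {..<N}" for s' unfolding bits_def by auto
  have finb: "finite (bits N s')" for s' using bN finite_subset by blast
  have dec: "set_decode (?code s') = bits N s'" for s' using finb by simp
  have finr: "finite (rest c)" for c unfolding rest_def by simp
  have loop: "exec W (Loop (var 19) (Seq test_flip next_subset)) s0 (\<lambda>t s'.
      t \<le> 400 * ((N + 1)\<^sup>2 * (\<Sum>j\<le>d. N choose j)) + 3 \<and>
      s' 2 0 = of_bool (a \<or> (\<exists>m < 2 ^ N. ?good m)))"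
    if s0: "listed \<sigma> d N f s0" "?I s0" "?code s0 = 0" "s0 19 0 = 1" for s0
  proof (rule exec_potential_loop[where I = ?I and \<Phi> = ?\<Phi>], goal_cases)
    case (2 s1)
    have l1: "listed \<sigma> d N f s1" by (rule listed_frame[OF s0(1) 2(2)]) auto
    let ?c = "?code s1"
    have go: "s1 19 0 \<noteq> 0" using 2(3) by simp
    have I1: "s1 17 N = 0" "s1 18 0 = card (bits N s1)" "card (bits N s1) \<le> d"
      "s1 2 0 = of_bool (a \<or> (\<exists>m < ?c. ?good m))"
      using 2(1) go by simp_all
    show ?case unfolding exec_Seq
    proof (rule exec_conseq[OF exec_test_flip[OF l1 N f refl I1(2)]], goal_cases)
      case (1 t s2)
      have l2: "listed \<sigma> d N f s2" by (rule listed_frame[OF l1 1(2)]) auto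
      have same: "s2 17 = s1 17" "s2 18 = s1 18" "s2 19 = s1 19" using 1(2) by auto
      have bits2: "bits N s2 = bits N s1" unfolding bits_def same ..
      have t: "t \<le> 220 * (N + 1)\<^sup>2" using 1(1) by simp
      have "(\<exists>m < Suc ?c. ?good m) \<longleftrightarrow> (\<exists>m < ?c. ?good m) \<or> good_clustering E {..<n} k (flip (f ` bits N s1) \<sigma>)"
        using I1(3) dec[of s1] by (auto simp: less_Suc_eq)
      then have ans2: "s2 2 0 = of_bool (a \<or> (\<exists>m < Suc ?c. ?good m))"
        using 1(1) I1(4) by simp
      show ?case
      proof (rule exec_conseq[OF exec_next_subset[of s2 d N]], goal_cases)
        case (8 u s3)
        then obtain q where q: "?c < q" "\<And>m. ?c < m \<Longrightarrow> m < q \<Longrightarrow> d < card (set_decode m)"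
            "if s3 19 0 = 0 then 2 ^ N \<le> q else ?code s3 = q"
          unfolding bits2 by blast
        have c: "?c < 2 ^ N" using set_encode_less[OF bN] .
        let ?b = "if s3 19 0 = 0 then 2 ^ N else ?code s3"
        have b: "?c < ?b" "?b \<le> q" using q(1,3) c by (auto split: if_splits)
        have small: "m < Suc ?c" if "m < ?b" "?good m" for m
        proof (rule ccontr)
          assume "\<not> m < Suc ?c"
          then have "?c < m" "m < q" using that(1) b(2) by linarith+
          then show False using q(2)[of m] that(2) by simp
        qed
        have "(\<exists>m < ?b. ?good m) \<longleftrightarrow> (\<exists>m < Suc ?c. ?good m)"
          using small b(1) by (meson less_Suc_eq_le order.strict_trans1)
        moreover have "s3 2 = s2 2" using 8(2) by simp
        ultimately have ans3: "s3 2 0 = of_bool (a \<or> (\<exists>m < ?b. ?good m))" using ans2 by simp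
        have cin: "?c \<in> rest ?c" unfolding rest_def using c I1(3) dec[of s1] by simp
        have drop: "?\<Phi> s3 + 400 * (N + 1)\<^sup>2 \<le> ?\<Phi> s1"
        proof (cases "s3 19 0 = 0")
          case True
          have "1 \<le> card (rest ?c)" using card_Suc_Diff1[OF finr cin] by linarith
          then show ?thesis using True go by simp
        next
          case False
          then have "rest (?code s3) \<subseteq> rest ?c - {?c}" using q(1,3) unfolding rest_def by auto
          then have "card (rest (?code s3)) \<le> card (rest ?c - {?c})" using finr by (intro card_mono) auto
          also have "Suc \<dots> = card (rest ?c)" using card_Suc_Diff1[OF finr cin] .
          finally have "400 * (N + 1)\<^sup>2 * Suc (card (rest (?code s3))) \<le> 400 * (N + 1)\<^sup>2 * card (rest ?c)"
            by (intro mult_le_mono2) simp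
          then show ?thesis using False go by simp
        qed
        have "(N + 1) * 1 \<le> (N + 1) * (N + 1)" by (intro mult_le_mono2) simp
        then have "N + 1 \<le> (N + 1)\<^sup>2" "1 \<le> (N + 1)\<^sup>2" by (simp_all add: power2_eq_square)
        moreover have "u \<le> 130 * (N + 1)" using 8(1) by simp
        ultimately have "t + u + 1 + expr_cost (var 19) \<le> 400 * (N + 1)\<^sup>2" using t by simp
        then have "?\<Phi> s3 + (t + u) + 1 + expr_cost (var 19) \<le> ?\<Phi> s1" using drop by linarith
        then show ?case using ans3 8(1) by blast
      qed (use listedD(3,4)[OF l2] same bits2 I1 go NW in simp_all)
    qed
  next
    case (3 t s')
    have "rest 0 = {m. m < 2 ^ N \<and> card (set_decode m) \<le> d}" unfolding rest_def by simp
    then have "card (rest 0) = (\<Sum>j\<le>d. N choose j)" using card_small_codes by simp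
    then show ?case using 3 s0 by simp
  qed (use s0 in auto)
  have ex: "(\<exists>m < 2 ^ N. ?good m) \<longleftrightarrow>
      (\<exists>T\<subseteq>{..<N}. card T \<le> d \<and> good_clustering E {..<n} k (flip (f ` T) \<sigma>))"
  proof
    assume "\<exists>m < 2 ^ N. ?good m"
    then show "\<exists>T\<subseteq>{..<N}. card T \<le> d \<and> good_clustering E {..<n} k (flip (f ` T) \<sigma>)"
      using set_decode_subset by blast
  next
    assume "\<exists>T\<subseteq>{..<N}. card T \<le> d \<and> good_clustering E {..<n} k (flip (f ` T) \<sigma>)"
    then obtain T where T: "T \<subseteq> {..<N}" "card T \<le> d" "good_clustering E {..<n} k (flip (f ` T) \<sigma>)" by blast
    have "set_decode (set_encode T) = T" using T(1) finite_subset by (intro set_encode_inverse) blast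
    then show "\<exists>m < 2 ^ N. ?good m" using T set_encode_less[OF T(1)] by (intro exI[of _ "set_encode T"]) simp
  qed
  show ?thesis unfolding enumerate_subsets_def exec_Seq
  proof (rule exec_for_loop[where m = "N + 1" and K = 4 and I = "\<lambda>j s'. \<forall>x<j. s' 17 x = 0"], goal_cases)
    case (7 t s')
    let ?s = "s'(18 := (s' 18)(0 := 0), 19 := (s' 19)(0 := 1))"
    have l': "listed \<sigma> d N f s'" by (rule listed_frame[OF s 7(2)]) auto
    have l0: "listed \<sigma> d N f ?s" by (rule listed_frame[OF l', where A = "{18, 19}"]) auto
    have b0: "bits N s' = {}" using 7(1) unfolding bits_def by auto
    have "s' 2 0 = of_bool a" using 7(2) a by simp
    then have "?I ?s" using b0 7(1) by simp
    then have "exec W (Loop (var 19) (Seq test_flip next_subset)) ?s (\<lambda>u. ?Q (t + (6 + u)))"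
      using b0 7(3) ex by (intro exec_conseq[OF loop[OF l0]]) simp_all
    then show ?case using NW by (auto elim: exec_conseq)
  qed (use listedD(4)[OF s] s NW in \<open>auto dest: listedD(4) simp: less_Suc_eq\<close>)
qed

section \<open>The search over all \<open>d\<close> and all start vertices\<close>

lemma evaluated_frame:
  assumes "evaluated \<sigma> s" "\<forall>a. a \<notin> A \<longrightarrow> s' a = s a" "A \<inter> {0, 1, 3, 5, 6, 7, 8, 9} = {}"
  shows "evaluated \<sigma> s'"
proof -
  have "s' a = s a" if "a \<in> {0, 1, 3, 5, 6, 7, 8, 9}" for a using assms that by blast
  then show ?thesis using assms(1) unfolding evaluated_def start_def tables_def by simp
qed

lemma tables_frame:
  assumes "tables s" "\<forall>a. a \<notin> A \<longrightarrow> s' a = s a" "A \<inter> {0, 1, 3} = {}"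
  shows "tables s'"
  using assms by (intro tables_cong[OF assms(1)]) blast+

text \<open>There are \<open>k div n + 1\<close> rounds because the guard is
  \<open>d * n \<le> k\<close>. No success is missed, since \<open>search_succeeds\<close> contains
  the same inequality through \<open>admissible\<close>.\<close>

lemma exec_search:
  assumes s: "evaluated \<sigma> s" "s 2 0 = of_bool a" and n: "0 < n"
  shows "exec W search s (\<lambda>t s'. t \<le> (k div n + 2) * (400 * B + 300 * (n + 1)) \<and>
    s' 2 0 = of_bool (a \<or> (\<exists>d. search_succeeds E {..<n} k \<sigma> d)))" (is "exec W _ _ ?Q")
proof -
  let ?ok = "search_succeeds E {..<n} k \<sigma>"
  let ?I = "\<lambda>j s. evaluated \<sigma> s \<and> s 12 0 = j \<and> s 13 0 = j * n \<and> s 2 0 = of_bool (a \<or> (\<exists>d<j. ?ok d))"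
  let ?K = "400 * B + 250 * (n + 1)"
  let ?body = "Seq collect_candidates
       (Seq (Cond (leq_expr (var 16) (double (Sub (Read 0 (Const 1)) (var 13)))) enumerate_subsets Skip)
       (Seq (incr 12) (assign 13 (Add (var 13) (var 0)))))"
  have d_le: "j * n \<le> k \<longleftrightarrow> j < k div n + 1" for j
    using n by (metis Suc_eq_plus1 less_Suc_eq_le less_eq_div_iff_mult_less_eq)
  have step: "exec W ?body s' (\<lambda>t s''. t \<le> ?K \<and> ?I (Suc j) s'')" if I: "?I j s'" and j: "j < k div n + 1" for j s'
  proof -
    let ?X = "candidates E {..<n} \<sigma> j"
    let ?N = "card ?X"
    have jn: "j * n \<le> k" using d_le j by blast
    have jW: "Suc j < W" using mult_le_mono2[of 1 n j] n jn less_W by linarith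
    have jnW: "j * n + n < W" using jn less_W by linarith
    have XV: "?X \<subseteq> {..<n}" unfolding candidates_def by auto
    then have N: "?N \<le> n" using card_mono[of "{..<n}" ?X] by simp
    show ?thesis unfolding exec_Seq
    proof (rule exec_conseq[OF exec_collect_candidates[of \<sigma> s' j]], goal_cases)
      case (3 t s1)
      let ?f = "s1 14"
      have bij: "bij_betw ?f {..<?N} ?X" and c: "s1 15 0 = ?N" "s1 16 0 = (?N - j) * (n - 6 * j)" "t \<le> 100 * (n + 1)"
        using 3(1) by auto
      have e1: "evaluated \<sigma> s1" by (rule evaluated_frame[OF _ 3(2)]) (use I in auto)
      have r1: "s1 12 0 = j" "s1 13 0 = j * n" "s1 2 0 = of_bool (a \<or> (\<exists>d<j. ?ok d))" "s1 0 0 = n" "s1 0 1 = k"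
        using 3(2) I e1 by (auto simp: evaluated_def start_def tables_def)
      have tail: "exec W (Seq (incr 12) (assign 13 (Add (var 13) (var 0)))) s2
          (\<lambda>t' s''. u + t' \<le> ?K \<and> ?I (Suc j) s'')"
        if "\<forall>a. a \<notin> writes enumerate_subsets \<longrightarrow> s2 a = s1 a"
          "s2 2 0 = of_bool (a \<or> (\<exists>d<j. ?ok d) \<or> ?ok j)" "u + 20 \<le> ?K" for s2 u
      proof -
        have e2: "evaluated \<sigma> s2" by (rule evaluated_frame[OF e1 that(1)]) auto
        have r2: "s2 12 0 = j" "s2 13 0 = j * n" "s2 0 0 = n" using that(1) r1 by auto
        have "evaluated \<sigma> (s2(12 := x, 13 := y))" for x y
          by (rule evaluated_frame[OF e2, where A = "{12, 13}"]) auto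
        then show ?thesis using that(2,3) r2 jW jnW by (auto simp: less_Suc_eq)
      qed
      show ?case
      proof (cases "admissible n k j ?N")
        case True
        have l1: "listed \<sigma> j ?N ?f s1" using e1 r1 c unfolding listed_def by simp
        have ok: "?ok j \<longleftrightarrow> (\<exists>T\<subseteq>{..<?N}. card T \<le> j \<and> good_clustering E {..<n} k (flip (?f ` T) \<sigma>))"
          unfolding subset_image_iff_bij_betw[OF bij, of j "\<lambda>D. good_clustering E {..<n} k (flip D \<sigma>)"]
          using True unfolding search_succeeds_def by simp
        have b: "(?N + 1)\<^sup>2 * (\<Sum>i\<le>j. ?N choose i) \<le> B" using work_le_B[OF N True] .
        have "exec W enumerate_subsets s1 (\<lambda>t' s2. exec W (Seq (incr 12) (assign 13 (Add (var 13) (var 0)))) s2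
            (\<lambda>t'' s''. (t + 20 + t') + t'' \<le> ?K \<and> ?I (Suc j) s''))"
        proof (rule exec_conseq[OF exec_enumerate_subsets[OF l1 N _ _ r1(3)]], goal_cases)
          case (3 t' s2)
          show ?case
          proof (rule tail[OF 3(2)], goal_cases)
            case 1
            then show ?case using 3(1) ok by simp
          next
            case 2
            have "t' \<le> 400 * B + 50 * (n + 1)"
              by (rule order.trans[OF conjunct1[OF 3(1)]]) (intro add_mono mult_le_mono2 b N order.refl)
            then show ?case using c(3) by simp
          qed
        qed (use bij XV in \<open>auto simp: bij_betw_def\<close>)
        moreover have "s1 16 0 < Suc (2 * (k - j * n))" using True c unfolding admissible_def by simp
        ultimately show ?thesis using r1 by (auto simp: mult_2 elim!: exec_conseq)
      next
        case False
        then have "\<not> s1 16 0 < Suc (2 * (k - j * n))" using jn c unfolding admissible_def by simp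
        moreover have "\<not> ?ok j" using False unfolding search_succeeds_def by simp
        then have "exec W (Seq (incr 12) (assign 13 (Add (var 13) (var 0)))) s1
            (\<lambda>t'' s''. (t + 20) + t'' \<le> ?K \<and> ?I (Suc j) s'')"
          by (intro tail) (use r1(3) c(3) in auto)
        ultimately show ?thesis using r1 by (auto simp: mult_2 elim!: exec_conseq)
      qed
    qed (use I in auto)
  qed
  let ?s = "s(12 := (s 12)(0 := 0), 13 := (s 13)(0 := 0))"
  have e: "evaluated \<sigma> ?s" by (rule evaluated_frame[OF s(1), where A = "{12, 13}"]) auto
  have "exec W (Loop (leq_expr (var 13) (Read 0 (Const 1))) ?body) ?s (\<lambda>t. ?Q (6 + t))"
  proof (rule exec_for[where m = "k div n + 1" and I = ?I and K = ?K], goal_cases)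
    case (2 j s')
    have "s' 0 1 = k" using 2(2) by (simp add: evaluated_def start_def tables_def)
    then show ?case using step[OF 2(2,1)] 2(2) d_le[of j] 2(1) by auto
  next
    case (3 s')
    have "s' 0 1 = k" using 3(1) by (simp add: evaluated_def start_def tables_def)
    then show ?case using d_le[of "k div n + 1"] 3(1) by auto
  next
    case (4 t s')
    have "d < k div n + 1" if "?ok d" for d
      using that d_le[of d] unfolding search_succeeds_def admissible_def by simp
    then have "(\<exists>d<k div n + 1. ?ok d) \<longleftrightarrow> (\<exists>d. ?ok d)" by blast
    moreover have "6 + t \<le> (k div n + 2) * (400 * B + 300 * (n + 1))"
      using 4(3) by (simp add: algebra_simps)
    ultimately show ?case using 4(1) by simp
  qed (use e s in auto)
  then show ?thesis unfolding search_def using less_W by (auto elim: exec_conseq)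
qed

lemma exec_evaluate_and_search:
  assumes s: "start \<sigma> s" "s 2 0 = of_bool a" and n: "0 < n"
  shows "exec W evaluate_and_search s (\<lambda>t s'.
    t \<le> 150 * (n + 1)\<^sup>2 + (k div n + 2) * (400 * B + 300 * (n + 1)) \<and> tables s' \<and>
    s' 2 0 = of_bool (a \<or> (\<exists>d. search_succeeds E {..<n} k \<sigma> d)))"
  unfolding evaluate_and_search_def exec_Seq
proof (rule exec_conseq[OF exec_conflict_matrix[OF s(1)]], goal_cases)
  case (1 t s1)
  have "s1 2 0 = of_bool a" using 1(2) s(2) by simp
  then show ?case
  proof (rule exec_conseq[OF exec_search[OF conjunct2[OF 1(1)] _ n]], goal_cases)
    case (1 t' s2)
    have "tables s2"
      by (rule tables_frame[OF _ 1(2)]) (use \<open>_ \<and> evaluated \<sigma> s1\<close> in \<open>auto simp: evaluated_def start_def\<close>)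
    then show ?case using 1(1) \<open>_ \<and> evaluated \<sigma> s1\<close> by auto
  qed
qed

lemma exec_clustering_prog:
  assumes s: "s 0 0 = n" "s 0 1 = k" "\<forall>u<n. \<forall>w<n. s 1 (u * n + w) = of_bool (E u w)" "s 2 0 = 0"
  shows "exec W clustering_prog s (\<lambda>t s'.
    t \<le> (n + 1) * (2 * ((k div n + 2) * (400 * B + 300 * (n + 1))) + 500 * (n + 1)\<^sup>2) \<and>
    s' 0 0 = of_bool (\<exists>\<sigma>. good_clustering E {..<n} k \<sigma>))" (is "exec W _ _ ?Q")
proof -
  let ?T = "(k div n + 2) * (400 * B + 300 * (n + 1))"
  let ?single = "\<lambda>v. \<exists>d. search_succeeds E {..<n} k (\<lambda>u. u = v) d"
  let ?nbhd = "\<lambda>v. \<exists>d. search_succeeds E {..<n} k (\<lambda>u. u = v \<or> E v u) d"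
  let ?I = "\<lambda>v s. tables s \<and> s 2 0 = of_bool (\<exists>v'<v. ?single v' \<or> ?nbhd v')"
  let ?K = "2 * ?T + 80 * (n + 1) + 300 * (n + 1)\<^sup>2"
  have step: "exec W search_from_vertex s' (\<lambda>t s''. t \<le> ?K \<and> ?I (Suc v) s'')"
    if v: "v < n" and I: "?I v s'" "s' 4 0 = v" for v s'
    unfolding search_from_vertex_def exec_Seq
  proof (rule exec_conseq[OF exec_singleton_start[OF conjunct1[OF I(1)] I(2)]], goal_cases)
    case (1 t1 s1)
    note t1 = conjunct1[OF 1(1)]
    have n: "0 < n" using v by simp
    have a1: "s1 2 0 = of_bool (\<exists>v'<v. ?single v' \<or> ?nbhd v')" "s1 4 0 = v" using 1(2) I by simp_all
    show ?case
    proof (rule exec_conseq[OF exec_evaluate_and_search[OF conjunct2[OF 1(1)] a1(1) n]], goal_cases)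
      case (1 t2 s2)
      note t2 = conjunct1[OF 1(1)]
      have a2: "tables s2" "s2 4 0 = v" "s2 2 0 = of_bool ((\<exists>v'<v. ?single v' \<or> ?nbhd v') \<or> ?single v)"
        using 1 a1(2) by simp_all
      show ?case
      proof (rule exec_conseq[OF exec_neighbourhood_start[OF a2(1,2) v]], goal_cases)
        case (1 t3 s3)
        note t3 = conjunct1[OF 1(1)]
        have a3: "s3 2 0 = of_bool ((\<exists>v'<v. ?single v' \<or> ?nbhd v') \<or> ?single v)" using 1(2) a2(3) by simp
        show ?case
        proof (rule exec_conseq[OF exec_evaluate_and_search[OF conjunct2[OF 1(1)] a3 n]], goal_cases)
          case (1 t4 s4)
          have "(\<exists>v'<Suc v. ?single v' \<or> ?nbhd v') \<longleftrightarrow>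
              ((\<exists>v'<v. ?single v' \<or> ?nbhd v') \<or> ?single v) \<or> ?nbhd v"
            by (auto simp: less_Suc_eq)
          moreover have "t1 + (t2 + (t3 + t4)) \<le> ?K"
            using t1 t2 t3 conjunct1[OF 1(1)] by linarith
          ultimately show ?case using 1(1) by simp
        qed
      qed
    qed
  qed
  \<comment> \<open>Singleton starts are searched with every \<open>d\<close>, whereas completeness
    refers to \<open>d = 0\<close> only; this is sound because any success exhibits a good
    clustering.\<close>
  have ans: "(\<exists>v<n. ?single v \<or> ?nbhd v) \<longleftrightarrow> (\<exists>\<sigma>. good_clustering E {..<n} k \<sigma>)"
  proof
    assume "\<exists>v<n. ?single v \<or> ?nbhd v"
    then show "\<exists>\<sigma>. good_clustering E {..<n} k \<sigma>" using good_clustering_if_search_succeeds by blast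
  next
    assume "\<exists>\<sigma>. good_clustering E {..<n} k \<sigma>"
    then show "\<exists>v<n. ?single v \<or> ?nbhd v"
      using search_complete[where V = "{..<n}" and E = E and k = k, OF finite_lessThan E_sym] by blast
  qed
  show ?thesis unfolding clustering_prog_def exec_Seq
  proof (rule exec_conseq[OF exec_mult_table[OF s(1-3)]], goal_cases)
    case (1 t s1)
    have a1: "?I 0 s1" using 1 s(4) by simp
    show ?case
    proof (rule exec_for_loop[where m = n and K = ?K and I = ?I], goal_cases)
      case (6 v s')
      then show ?case using step by blast
    next
      case (7 t' s')
      have "(n + 1) * 1 \<le> (n + 1) * (n + 1)" by (intro mult_le_mono2) simp
      then have "n + 1 \<le> (n + 1)\<^sup>2" by (simp add: power2_eq_square)
      moreover have "2 * c + 80 * m + 300 * q + 12 + 35 \<le> 2 * c + 500 * q" if "m \<le> q" "1 \<le> q" for c m q :: nat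
        using that by linarith
      ultimately have "?K + 12 + 35 \<le> 2 * ?T + 500 * (n + 1)\<^sup>2" by simp
      then have "(n + 1) * (?K + 12 + 35) \<le> (n + 1) * (2 * ?T + 500 * (n + 1)\<^sup>2)" by (rule mult_le_mono2)
      then have slack: "(n + 1) * (?K + 12) + (n + 1) * 35 \<le> (n + 1) * (2 * ?T + 500 * (n + 1)\<^sup>2)"
        unfolding add_mult_distrib2[of "n + 1" "?K + 12" 35] .
      have t': "t' \<le> (n + 1) * (?K + 12)"
      proof -
        have "c + 10 + expr_cost (var 0) = c + 12" for c by simp
        then show ?thesis using 7(3) by (simp only:)
      qed
      have arith: "x + (y + 4) \<le> z" if "x \<le> 30 * (n + 1)" "y \<le> c" "c + (n + 1) * 35 \<le> z" for x y z c
        using that by simp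
      have "t + (t' + 4) \<le> (n + 1) * (2 * ?T + 500 * (n + 1)\<^sup>2)"
        by (rule arith[OF conjunct1[OF 1(1)] t' slack])
      moreover have "s' 2 0 = of_bool (\<exists>\<sigma>. good_clustering E {..<n} k \<sigma>)" using 7(1) unfolding ans by simp
      ultimately show ?case using less_W(1) by simp
    qed (use a1 less_W tables_cong in \<open>auto simp: tables_def\<close>)
  qed
qed

end

section \<open>From the work bound to the final running time\<close>

lemma input_store_adjacency:
  assumes "u < n" "w < n"
  shows "input_store n G k 1 (u * n + w) = of_bool ((u, w) \<in> parcs G)"
  using assms row_index_less[OF assms] by (simp add: input_store_def)

text \<open>Below n^2/4, \<open>B\<close> is the real bound divided by r + 1 and rounded down, which
  still dominates every natural number below that quotient. From n^2/4 on no time bound is claimed,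
  and the crude \<open>2 ^ n\<close> lets the same correctness proof apply.\<close>

lemma work_bound_exists:
  assumes C0: "C0 > 0" "\<And>n k d N. 0 < n \<Longrightarrow> 4 * real k < (real n)\<^sup>2 \<Longrightarrow> N \<le> n \<Longrightarrow> admissible n k d N \<Longrightarrow>
      (real k / real n + 1) * (real N + 1)\<^sup>2 * real (\<Sum>j\<le>d. N choose j) \<le> C0 * 2.619 powr search_exponent n k"
  obtains B where "\<And>N d. N \<le> n \<Longrightarrow> admissible n k d N \<Longrightarrow> (N + 1)\<^sup>2 * (\<Sum>j\<le>d. N choose j) \<le> B"
    and "4 * real k < (real n)\<^sup>2 \<Longrightarrow> (real k / real n + 1) * real B \<le> C0 * 2.619 powr search_exponent n k"
proof (cases "4 * real k < (real n)\<^sup>2")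
  case True
  then have n: "0 < n" by (cases n) auto
  let ?Y = "C0 * 2.619 powr search_exponent n k"
  let ?r = "real k / real n + 1"
  have r: "?r > 0" by (simp add: add_nonneg_pos)
  have "?Y / ?r \<ge> 0" using C0(1) r by (intro divide_nonneg_pos) auto
  then have B: "real (nat \<lfloor>?Y / ?r\<rfloor>) \<le> ?Y / ?r" by (simp add: of_nat_nat)
  show ?thesis
  proof (rule that)
    fix N d assume N: "N \<le> n" "admissible n k d N"
    have "?r * real ((N + 1)\<^sup>2 * (\<Sum>j\<le>d. N choose j)) \<le> ?Y" using C0(2)[OF n True N] by (simp add: mult.assoc add.commute)
    then have "real ((N + 1)\<^sup>2 * (\<Sum>j\<le>d. N choose j)) \<le> ?Y / ?r"
      using r by (simp only: pos_le_divide_eq mult.commute)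
    then show "(N + 1)\<^sup>2 * (\<Sum>j\<le>d. N choose j) \<le> nat \<lfloor>?Y / ?r\<rfloor>" by (rule le_nat_floor)
  next
    show "?r * real (nat \<lfloor>?Y / ?r\<rfloor>) \<le> ?Y" using B r by (simp only: pos_le_divide_eq mult.commute)
  qed
next
  case False
  show ?thesis
  proof (rule that)
    fix N d assume N: "N \<le> n"
    have "real (\<Sum>j\<le>d. N choose j) \<le> real (2 ^ N)" using sum_binomial_le[of 1 N d] by simp
    then have "(\<Sum>j\<le>d. N choose j) \<le> 2 ^ N" by (simp only: of_nat_le_iff)
    also have "\<dots> \<le> 2 ^ n" using N by simp
    finally show "(N + 1)\<^sup>2 * (\<Sum>j\<le>d. N choose j) \<le> (n + 1)\<^sup>2 * 2 ^ n"
      using N by (intro mult_le_mono power_mono) auto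
  qed (use False in simp)
qed

text \<open>The \<open>B\<close> part becomes n Y through the factor r + 1. All else is cubic in m =
  n + 1, since r + 1 <= m. With m <= 2 n, the constants are 2 * 1600 and 8 * 1700.\<close>

lemma running_time_le:
  fixes Y C0 :: real
  assumes n: "0 < n" and k: "4 * real k < (real n)\<^sup>2"
    and B: "(real k / real n + 1) * real B \<le> C0 * Y"
    and t: "t \<le> (n + 1) * (2 * ((k div n + 2) * (400 * B + 300 * (n + 1))) + 500 * (n + 1)\<^sup>2)"
    and pos: "C0 > 0" "Y \<ge> 0"
  shows "real t \<le> (3200 * C0 + 13600) * (real n * Y + real n ^ 3)"
proof -
  define r where "r = real k / real n"
  define m where "m = real n + 1"
  have r: "0 \<le> r" unfolding r_def by simp
  have "real k \<le> real n * real n" using k by (simp add: power2_eq_square)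
  then have rm: "r + 1 \<le> m" using n unfolding r_def m_def by (simp add: divide_le_eq)
  have m: "0 \<le> m" "m \<le> 2 * real n" using n unfolding m_def by auto
  have "real (k div n) \<le> r" unfolding r_def by (rule of_nat_div_le_of_nat)
  then have dv: "real (k div n) + 2 \<le> 2 * (r + 1)" using r by simp
  have "real t \<le> m * (2 * ((real (k div n) + 2) * (400 * real B + 300 * m)) + 500 * m\<^sup>2)"
    using t[THEN of_nat_mono, where 'a = real] unfolding m_def by (simp add: algebra_simps)
  also have "\<dots> \<le> m * (2 * (2 * (r + 1) * (400 * real B + 300 * m)) + 500 * m\<^sup>2)"
    using dv m by (intro mult_left_mono add_mono mult_right_mono order.refl) auto
  also have "\<dots> = m * (1600 * ((r + 1) * real B) + 1200 * ((r + 1) * m) + 500 * m\<^sup>2)"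
    by (simp add: algebra_simps)
  also have "\<dots> \<le> m * (1600 * (C0 * Y) + 1200 * (m * m) + 500 * m\<^sup>2)"
    using B rm m unfolding r_def[symmetric]
    by (intro mult_left_mono add_mono mult_right_mono order.refl) auto
  also have "\<dots> = 1600 * (C0 * Y) * m + 1700 * m ^ 3"
    by (simp add: algebra_simps power2_eq_square power3_eq_cube)
  also have "\<dots> \<le> 1600 * (C0 * Y) * (2 * real n) + 1700 * (2 * real n) ^ 3"
    using m pos by (intro add_mono mult_left_mono power_mono) auto
  also have "\<dots> = 3200 * C0 * (real n * Y) + 13600 * real n ^ 3"
    by (simp add: power_mult_distrib)
  also have "\<dots> \<le> (3200 * C0 + 13600) * (real n * Y) + (3200 * C0 + 13600) * real n ^ 3"
    using pos by (intro add_mono mult_right_mono) auto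
  finally show ?thesis by (simp add: distrib_left)
qed

text \<open>For n > 0 and k = n^2/4 the denominator 1 - 4 r / n is 0, and division in HOL would make
  the exponent 0; a time bound there would claim cubic time, so it is asserted only below that
  value. The word bound \<open>(n + 2) ^ d\<close> amounts to words of O(log n) bits.\<close>

theorem theorem1:
  shows "\<exists>(p :: prog) (d :: nat) (C :: real).
    \<forall>(n :: nat) (G :: nat pair_pre_digraph) (k :: nat).
      pair_graph G \<and> pverts G = {..<n} \<and> real k \<le> (real n)\<^sup>2 / 4 \<longrightarrow>
      (\<exists>t s. run ((n + 2) ^ d) p (input_store n G k) t s \<and>
        s 0 0 = (if min_sum_2_clustering G k then 1 else 0) \<and>
        (real k < (real n)\<^sup>2 / 4 \<longrightarrow>
          (let r = real k / real n in
            real t \<le> C * (real n * 2.619 powr (r / (1 - 4 * r / real n)) + real n ^ 3))))"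
proof -
  obtain C0 where C0: "C0 > 0" "\<And>n k d N. 0 < n \<Longrightarrow> 4 * real k < (real n)\<^sup>2 \<Longrightarrow> N \<le> n \<Longrightarrow> admissible n k d N \<Longrightarrow>
      (real k / real n + 1) * (real N + 1)\<^sup>2 * real (\<Sum>j\<le>d. N choose j) \<le> C0 * 2.619 powr search_exponent n k"
    using search_size_bound by blast
  have main: "\<exists>t s. run ((n + 2) ^ 5) clustering_prog (input_store n G k) t s \<and>
      s 0 0 = (if min_sum_2_clustering G k then 1 else 0) \<and>
      (real k < (real n)\<^sup>2 / 4 \<longrightarrow>
        (let r = real k / real n in
          real t \<le> (3200 * C0 + 13600) * (real n * 2.619 powr (r / (1 - 4 * r / real n)) + real n ^ 3)))"
    if G: "pair_graph G" "pverts G = {..<n}" and k: "real k \<le> (real n)\<^sup>2 / 4" for n G k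
  proof -
    let ?E = "\<lambda>u w. (u, w) \<in> parcs G"
    interpret pair_graph G by fact
    obtain B where work: "\<And>N d. N \<le> n \<Longrightarrow> admissible n k d N \<Longrightarrow> (N + 1)\<^sup>2 * (\<Sum>j\<le>d. N choose j) \<le> B"
      "4 * real k < (real n)\<^sup>2 \<Longrightarrow> (real k / real n + 1) * real B \<le> C0 * 2.619 powr search_exponent n k"
      using work_bound_exists[OF C0] by blast
    have "real k \<le> real (n * n)" using k by (simp add: power2_eq_square)
    then have kn: "k \<le> n * n" by (simp only: of_nat_le_iff)
    \<comment> \<open>The factor 8 = 2^3 is absorbed by \<open>(n + 2) ^ 3\<close>, which explains
      the power 5 of the word bound.\<close>
    have "8 * ((n + 1) * (n + 1)) < 8 * ((n + 2) * (n + 2))" by simp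
    also have "\<dots> = 2 ^ 3 * (n + 2) ^ 2" by (simp add: power2_eq_square)
    also have "\<dots> \<le> (n + 2) ^ 3 * (n + 2) ^ 2" by (intro mult_le_mono1 power_mono) auto
    also have "\<dots> = (n + 2) ^ 5" by (simp flip: power_add)
    finally have W: "8 * ((n + 1) * (n + 1)) < (n + 2) ^ 5" .
    interpret clustering_instance ?E n k "(n + 2) ^ 5" B
      by unfold_locales (use kn W work(1) arcs_symmetric in auto)
    have "exec ((n + 2) ^ 5) clustering_prog (input_store n G k) (\<lambda>t s'.
      t \<le> (n + 1) * (2 * ((k div n + 2) * (400 * B + 300 * (n + 1))) + 500 * (n + 1)\<^sup>2) \<and>
      s' 0 0 = of_bool (\<exists>\<sigma>. good_clustering ?E {..<n} k \<sigma>))"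
      by (rule exec_clustering_prog) (use input_store_adjacency in \<open>simp_all add: input_store_def\<close>)
    then obtain t s where ts: "run ((n + 2) ^ 5) clustering_prog (input_store n G k) t s"
      "t \<le> (n + 1) * (2 * ((k div n + 2) * (400 * B + 300 * (n + 1))) + 500 * (n + 1)\<^sup>2)"
      "s 0 0 = of_bool (\<exists>\<sigma>. good_clustering ?E {..<n} k \<sigma>)"
      unfolding exec_def by blast
    have "s 0 0 = (if min_sum_2_clustering G k then 1 else 0)"
      using ts(3) min_sum_2_clustering_iff[OF G(1), of k] G(2) by simp
    moreover have "real t \<le> (3200 * C0 + 13600) * (real n * 2.619 powr search_exponent n k + real n ^ 3)"
      if "real k < (real n)\<^sup>2 / 4"
    proof -
      have k4: "4 * real k < (real n)\<^sup>2" using that by simp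
      then have "0 < n" by (cases n) auto
      then show ?thesis using running_time_le[OF _ k4 work(2)[OF k4] ts(2) C0(1)] by simp
    qed
    ultimately show ?thesis using ts(1) unfolding search_exponent_def Let_def
      by (intro exI[of _ t] exI[of _ s]) simp
  qed
  show ?thesis
    by (rule exI[of _ clustering_prog], rule exI[of _ 5], rule exI[of _ "3200 * C0 + 13600"],
        intro allI impI, rule main) auto
qed

end
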